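(* Let $\mathbb{K}$ be an algebraically closed field of characteristic zero, let $m,s$ be positive integers and let $c_1,\dots,c_s,d_1,\dots,d_m\in\mathbb{Z}_{\ge 0}$. Then the subgroup $G=\langle H_{c_1},\ldots,H_{c_s},K_{d_1},\ldots,K_{d_m}\rangle$ of $\mathrm{Aut}(\mathbb{A}^2)$ acts on $\mathbb{A}^2\setminus\{0\}$ infinitely transitively if and only if the vectors $(-1,c_1),\ldots,(-1,c_s),(d_1,-1),\ldots,(d_m,-1)$ generate $\mathbb{Z}^2$ as an abelian group.
   Context: $\mathbb{A}^2$ is the affine plane over $\mathbb{K}$ with coordinates $(x,y)$, $0$ denotes the origin, and $\mathrm{Aut}(\mathbb{A}^2)$ is its group of polynomial automorphisms. For $a,b\in\mathbb{Z}_{\ge 0}$, $H_a$ is the one-parameter subgroup of $\mathrm{Aut}(\mathbb{A}^2)$ consisting of all maps $(x,y)\mapsto(x+\alpha y^a,\,y)$, $\alpha\in\mathbb{K}$, and $K_b$ is the one consisting of all maps $(x,y)\mapsto(x,\,y+\beta x^b)$, $\beta\in\mathbb{K}$. $\langle\cdots\rangle$ denotes the subgroup generated (as an abstract group). A group $G$ acts on a set $X$ infinitely transitively if for every positive integer $n$ and any two tuples $(p_1,\dots,p_n)$, $(q_1,\dots,q_n)$, each consisting of pairwise distinct points of $X$, there is $g\in G$ with $g\cdot p_i=q_i$ for all $i=1,\dots,n$.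
   Formalization: The formal theorem additionally assumes that G acts on A²∖{0}, equivalently that all c_i and d_j are positive; if some exponent is 0, G contains translations moving the origin while the vectors always generate Z², so the equivalence fails as stated. *)

theory Defs
  imports
    "HOL-Computational_Algebra.Polynomial"
    "HOL-Algebra.Group_Action"
    "HOL-Algebra.Elementary_Groups"
begin

text \<open>
  A bivariate polynomial over \<open>'a\<close> is represented by an \<open>'a poly poly\<close>: the inner variable is
  \<open>x\<close>, the outer variable is \<open>y\<close>. Polynomial maps are identified with the functions they
  induce on points, which loses nothing over an infinite field.
\<close>

definition bipoly :: "'a::comm_ring_1 poly poly \<Rightarrow> 'a \<times> 'a \<Rightarrow> 'a"
  where "bipoly P = (\<lambda>(x, y). poly (poly P [:y:]) x)"

definition polynomial_map :: "('a::comm_ring_1 \<times> 'a \<Rightarrow> 'a \<times> 'a) \<Rightarrow> bool"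
  where "polynomial_map f \<longleftrightarrow> (\<exists>P Q. f = (\<lambda>p. (bipoly P p, bipoly Q p)))"

definition Aut_plane :: "('a::comm_ring_1 \<times> 'a \<Rightarrow> 'a \<times> 'a) monoid"
  where "Aut_plane =
    \<lparr>carrier = {f. bij f \<and> polynomial_map f \<and> polynomial_map (inv_into UNIV f)},
     mult = (\<circ>), one = id\<rparr>"

definition H :: "nat \<Rightarrow> ('a::comm_ring_1 \<times> 'a \<Rightarrow> 'a \<times> 'a) set"
  where "H a = range (\<lambda>\<alpha>. \<lambda>(x, y). (x + \<alpha> * y ^ a, y))"

definition K :: "nat \<Rightarrow> ('a::comm_ring_1 \<times> 'a \<Rightarrow> 'a \<times> 'a) set"
  where "K b = range (\<lambda>\<beta>. \<lambda>(x, y). (x, y + \<beta> * x ^ b))"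

definition punctured_plane :: "('a::comm_ring_1 \<times> 'a) set"
  where "punctured_plane = UNIV - {(0, 0)}"

text \<open>
  The natural action of a group of self-maps on \<open>X\<close>. The restriction is needed because
  \<^const>\<open>BijGroup\<close> consists of extensional functions. It is a \<^const>\<open>group_action\<close> only if all
  elements of the group map \<open>X\<close> bijectively onto \<open>X\<close>.
\<close>

definition natural_action :: "'x set \<Rightarrow> ('x \<Rightarrow> 'x) \<Rightarrow> 'x \<Rightarrow> 'x"
  where "natural_action X = (\<lambda>g. restrict g X)"

definition infinitely_transitive ::
    "('g, 'r) monoid_scheme \<Rightarrow> 'x set \<Rightarrow> ('g \<Rightarrow> 'x \<Rightarrow> 'x) \<Rightarrow> bool"
  where "infinitely_transitive G X \<phi> \<longleftrightarrow> group_action G X \<phi> \<and>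
    (\<forall>n>0. \<forall>p q :: nat \<Rightarrow> 'x.
       p \<in> {1..n} \<rightarrow> X \<and> inj_on p {1..n} \<and> q \<in> {1..n} \<rightarrow> X \<and> inj_on q {1..n} \<longrightarrow>
       (\<exists>g\<in>carrier G. \<forall>i\<in>{1..n}. \<phi> g (p i) = q i))"

text \<open>
  \<^const>\<open>Aut_plane\<close> is a group containing the sets \<^const>\<open>H\<close> and \<^const>\<open>K\<close>, so the
  intersection with the carrier built into \<^const>\<open>subgroup_generated\<close> discards no generator.
\<close>

lemma bipoly_const: "bipoly [:[:c:]:] = (\<lambda>p. c)"
  by (auto simp: bipoly_def)

lemma bipoly_fst: "bipoly [:[:0, 1:]:] = fst"
  by (auto simp: bipoly_def)

lemma bipoly_snd: "bipoly [:0, 1:] = snd"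
  by (auto simp: bipoly_def)

lemma bipoly_add: "bipoly (P + Q) = (\<lambda>p. bipoly P p + bipoly Q p)"
  by (auto simp: bipoly_def)

lemma bipoly_mult: "bipoly (P * Q) = (\<lambda>p. bipoly P p * bipoly Q p)"
  by (auto simp: bipoly_def)

lemma bipoly_power: "bipoly (P ^ n) = (\<lambda>p. bipoly P p ^ n)"
  by (auto simp: bipoly_def poly_power)

lemma bipoly_compose: "\<exists>S. \<forall>p. bipoly S p = bipoly P (bipoly Q p, bipoly R p)"
proof (induction P)
  case 0
  show ?case by (rule exI[of _ 0]) (auto simp: bipoly_def)
next
  case (pCons a P)
  then obtain S where S: "\<And>p. bipoly S p = bipoly P (bipoly Q p, bipoly R p)" by blast
  have "\<exists>T. \<forall>p. bipoly T p = poly a (bipoly Q p)"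
  proof (induction a)
    case 0
    show ?case by (rule exI[of _ 0]) (auto simp: bipoly_def)
  next
    case (pCons c a)
    then obtain T where "\<And>p. bipoly T p = poly a (bipoly Q p)" by blast
    then show ?case
      by (intro exI[of _ "[:[:c:]:] + Q * T"]) (simp only: bipoly_add bipoly_mult bipoly_const poly_pCons, simp)
  qed
  then obtain T where T: "\<And>p. bipoly T p = poly a (bipoly Q p)" by blast
  have "bipoly (pCons a P) (u, v) = poly a u + v * bipoly P (u, v)" for u v
    by (simp add: bipoly_def)
  then show ?case
    by (intro exI[of _ "T + R * S"]) (simp add: bipoly_add bipoly_mult S T)
qed

lemma polynomial_map_compose:
  assumes "polynomial_map f" "polynomial_map g"
  shows "polynomial_map (f \<circ> g)"
proof -
  obtain P Q where f: "f = (\<lambda>p. (bipoly P p, bipoly Q p))"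
    using assms(1) by (auto simp: polynomial_map_def)
  obtain P' Q' where g: "g = (\<lambda>p. (bipoly P' p, bipoly Q' p))"
    using assms(2) by (auto simp: polynomial_map_def)
  obtain S T where "\<forall>p. bipoly S p = bipoly P (bipoly P' p, bipoly Q' p)"
    "\<forall>p. bipoly T p = bipoly Q (bipoly P' p, bipoly Q' p)"
    using bipoly_compose by metis
  then show ?thesis
    unfolding polynomial_map_def f g by (intro exI[of _ S] exI[of _ T]) auto
qed

lemma polynomial_map_id: "polynomial_map id"
  unfolding polynomial_map_def
  by (intro exI[of _ "[:[:0, 1:]:]"] exI[of _ "[:0, 1:]"]) (auto simp: bipoly_fst bipoly_snd)

lemma group_Aut_plane: "group Aut_plane"
proof (rule groupI)
  fix f g :: "'a \<times> 'a \<Rightarrow> 'a \<times> 'a"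
  assume "f \<in> carrier Aut_plane" "g \<in> carrier Aut_plane"
  then show "f \<otimes>\<^bsub>Aut_plane\<^esub> g \<in> carrier Aut_plane"
    by (auto simp: Aut_plane_def bij_comp o_inv_distrib intro: polynomial_map_compose)
next
  fix f :: "'a \<times> 'a \<Rightarrow> 'a \<times> 'a"
  assume "f \<in> carrier Aut_plane"
  then show "\<exists>g\<in>carrier Aut_plane. g \<otimes>\<^bsub>Aut_plane\<^esub> f = \<one>\<^bsub>Aut_plane\<^esub>"
    by (intro bexI[of _ "inv_into UNIV f"])
       (auto simp: Aut_plane_def bij_imp_bij_inv inv_inv_eq bij_is_inj)
qed (auto simp: Aut_plane_def polynomial_map_id comp_assoc)

lemma Aut_planeI:
  assumes "polynomial_map f" "polynomial_map g" "f \<circ> g = id" "g \<circ> f = id"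
  shows "f \<in> carrier Aut_plane"
  using assms inv_unique_comp[of f g] by (auto simp: Aut_plane_def o_bij)

lemma H_subset_Aut_plane: "H a \<subseteq> carrier Aut_plane"
proof -
  have *: "polynomial_map (\<lambda>(x, y). (x + \<alpha> * y ^ a, y))" for \<alpha> :: 'a
    unfolding polynomial_map_def
    by (intro exI[of _ "[:[:0, 1:]:] + [:[:\<alpha>:]:] * [:0, 1:] ^ a"] exI[of _ "[:0, 1:]"])
       (simp only: bipoly_add bipoly_mult bipoly_power bipoly_const bipoly_fst bipoly_snd, auto)
  show ?thesis
    unfolding H_def
    by (auto intro!: Aut_planeI[OF * *[of "- _"]])
qed

lemma K_subset_Aut_plane: "K b \<subseteq> carrier Aut_plane"
proof -
  have *: "polynomial_map (\<lambda>(x, y). (x, y + \<beta> * x ^ b))" for \<beta> :: 'a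
    unfolding polynomial_map_def
    by (intro exI[of _ "[:[:0, 1:]:]"] exI[of _ "[:0, 1:] + [:[:\<beta>:]:] * [:[:0, 1:]:] ^ b"])
       (simp only: bipoly_add bipoly_mult bipoly_power bipoly_const bipoly_fst bipoly_snd, auto)
  show ?thesis
    unfolding K_def
    by (auto intro!: Aut_planeI[OF * *[of "- _"]])
qed

text \<open>
  A vanishing exponent gives translations, which do not preserve the punctured plane; for
  positive exponents every generator fixes the origin. So the group generated by the given
  one-parameter subgroups acts on the punctured plane exactly when no exponent vanishes.
\<close>

lemma natural_action_iff:
  fixes A :: "('a::field_char_0 \<times> 'a \<Rightarrow> 'a \<times> 'a) set"
  assumes "A \<subseteq> carrier Aut_plane"
  shows "group_action (subgroup_generated Aut_plane A) punctured_plane (natural_action punctured_plane)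
    \<longleftrightarrow> (\<forall>g\<in>A. g (0, 0) = (0, 0))"
proof
  let ?G = "subgroup_generated Aut_plane A"
  interpret Aut: group "Aut_plane :: ('a \<times> 'a \<Rightarrow> 'a \<times> 'a) monoid" by (rule group_Aut_plane)
  have bij: "bij g" if "g \<in> carrier Aut_plane" for g :: "'a \<times> 'a \<Rightarrow> 'a \<times> 'a"
    using that by (simp add: Aut_plane_def)
  {
    assume act: "group_action ?G punctured_plane (natural_action punctured_plane)"
    show "\<forall>g\<in>A. g (0, 0) = (0, 0)"
    proof
      fix g assume g: "g \<in> A"
      then have "g \<in> carrier ?G"
        using assms by (auto simp: carrier_subgroup_generated intro: generate.incl)
      then have "bij_betw (natural_action punctured_plane g) punctured_plane punctured_plane"
        using group_action.bij_prop0[OF act] by (auto simp: Bij_def)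
      then have im: "g ` punctured_plane = punctured_plane"
        by (auto simp: bij_betw_def natural_action_def)
      have "bij g" using g assms bij by blast
      then obtain p where p: "g p = (0, 0)" by (metis bij_pointE)
      with im have "p \<notin> punctured_plane" by (force simp: punctured_plane_def)
      with p show "g (0, 0) = (0, 0)" by (simp add: punctured_plane_def)
    qed
  }
  {
    assume fix0: "\<forall>g\<in>A. g (0, 0) = (0, 0)"
    have sub: "carrier ?G \<subseteq> carrier Aut_plane"
      by (rule Aut.carrier_subgroup_generated_subset)
    have inv_eq: "inv\<^bsub>Aut_plane\<^esub> g = inv_into UNIV g" if "g \<in> carrier Aut_plane" for g :: "'a \<times> 'a \<Rightarrow> 'a \<times> 'a"
      using that
      by (intro Aut.inv_equality) (auto simp: Aut_plane_def bij_imp_bij_inv inv_inv_eq bij_is_inj)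
    have fixG: "g (0, 0) = (0, 0)" if "g \<in> carrier ?G" for g
    proof -
      from that have "g \<in> generate Aut_plane (carrier Aut_plane \<inter> A)"
        by (simp add: carrier_subgroup_generated)
      then show ?thesis
      proof (induction rule: generate.induct)
        case one
        then show ?case by (simp add: Aut_plane_def)
      next
        case (incl h)
        then show ?case using fix0 by auto
      next
        case (inv h)
        then have "h (0, 0) = (0, 0)" "bij h" using fix0 bij by auto
        then show ?case
          using inv.hyps by (simp add: inv_eq) (metis bij_inv_eq_iff)
      next
        case (eng h1 h2)
        then show ?case by (simp add: Aut_plane_def)
      qed
    qed
    have im: "g ` punctured_plane = punctured_plane" if "g \<in> carrier ?G" for g
    proof -
      have "bij g" using that sub bij by blast
      then show ?thesis
        unfolding punctured_plane_def
        using fixG[OF that] by (simp add: bij_def image_set_diff)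
    qed
    have Bij: "natural_action punctured_plane g \<in> Bij punctured_plane" if "g \<in> carrier ?G" for g
    proof -
      have "inj g" using that sub bij bij_is_inj by blast
      with im[OF that] show ?thesis
        by (auto simp: Bij_def natural_action_def bij_betw_def intro: inj_on_subset)
    qed
    have "natural_action punctured_plane \<in> hom ?G (BijGroup punctured_plane)"
    proof (rule homI)
      fix f g assume fg: "f \<in> carrier ?G" "g \<in> carrier ?G"
      have "compose punctured_plane (restrict f punctured_plane) (restrict g punctured_plane) =
        restrict (f \<circ> g) punctured_plane"
        using im[OF fg(2)] by (auto simp: compose_def restrict_def fun_eq_iff)
      with fg Bij show "natural_action punctured_plane (f \<otimes>\<^bsub>?G\<^esub> g) =
          natural_action punctured_plane f \<otimes>\<^bsub>BijGroup punctured_plane\<^esub> natural_action punctured_plane g"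
        by (simp add: BijGroup_def) (simp add: natural_action_def Aut_plane_def)
    qed (simp add: BijGroup_def Bij)
    then show "group_action ?G punctured_plane (natural_action punctured_plane)"
      by (simp add: group_action_def group_hom_def group_hom_axioms_def group_BijGroup
          Aut.group_subgroup_generated)
  }
qed

lemma natural_action_H_K_iff:
  fixes c d :: "nat \<Rightarrow> nat" and s m :: nat
  defines "A \<equiv> (\<Union>i\<in>{1..s}. H (c i)) \<union> (\<Union>j\<in>{1..m}. K (d j)) ::
    ('a::field_char_0 \<times> 'a \<Rightarrow> 'a \<times> 'a) set"
  shows "group_action (subgroup_generated Aut_plane A) punctured_plane (natural_action punctured_plane)
    \<longleftrightarrow> (\<forall>i\<in>{1..s}. c i > 0) \<and> (\<forall>j\<in>{1..m}. d j > 0)"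
proof -
  have H: "(\<forall>g\<in>H a :: ('a \<times> 'a \<Rightarrow> 'a \<times> 'a) set. g (0, 0) = (0, 0)) \<longleftrightarrow> a > 0" for a
    by (auto simp: H_def power_0_left intro: exI[of _ 1])
  have K: "(\<forall>g\<in>K a :: ('a \<times> 'a \<Rightarrow> 'a \<times> 'a) set. g (0, 0) = (0, 0)) \<longleftrightarrow> a > 0" for a
    by (auto simp: K_def power_0_left intro: exI[of _ 1])
  have "A \<subseteq> carrier Aut_plane"
    using H_subset_Aut_plane K_subset_Aut_plane by (force simp: A_def)
  then have "group_action (subgroup_generated Aut_plane A) punctured_plane (natural_action punctured_plane)
    \<longleftrightarrow> (\<forall>g\<in>A. g (0, 0) = (0, 0))"
    by (rule natural_action_iff)
  also have "\<dots> \<longleftrightarrow> (\<forall>i\<in>{1..s}. \<forall>g\<in>H (c i) :: ('a \<times> 'a \<Rightarrow> 'a \<times> 'a) set. g (0, 0) = (0, 0)) \<and>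
      (\<forall>j\<in>{1..m}. \<forall>g\<in>K (d j) :: ('a \<times> 'a \<Rightarrow> 'a \<times> 'a) set. g (0, 0) = (0, 0))"
    unfolding A_def by blast
  finally show ?thesis by (simp only: H K)
qed

end

theory Submission
  imports Defs
begin

text \<open>
  Necessity: if the vectors lie in a proper sublattice, a nontrivial element of the diagonal torus
  commutes with \<open>G\<close>, so \<open>G\<close> is not \<open>2\<close>-transitive.

  Sufficiency is an induction on the number of points. Call \<open>x \<circ> g\<close> and \<open>y \<circ> g\<close> with \<open>g \<in> G\<close>
  coordinates. Every nonzero level curve of a coordinate \<open>F\<close> is an orbit of a conjugate of some
  \<open>H\<close> or \<open>K\<close> that fixes the zero set of \<open>F\<close> pointwise. Over an algebraically closed field a
  coordinate that is not constant on such a curve, which is a polynomial image of the line, takes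
  all values on it. So level curves of different coordinates that vanish on a set \<open>P\<close> meet, and the
  pointwise stabilizer of \<open>P\<close> is transitive off the set \<open>cl P\<close> of common zeros of these coordinates.

  It remains to see that \<open>cl P = P\<close>. If \<open>G\<close> is transitive on \<open>N\<close>-sets, then the sets \<open>cl P\<close> with
  \<open>card P = N\<close> all have the same cardinality and form a Steiner system, so
  \<open>card (cl P) - (N - 1)\<close> divides \<open>card Z - (N - 1)\<close> for all finite common zero sets \<open>Z\<close> of
  coordinates with at least \<open>N\<close> points. Explicit words in the shears, the last one with a generic
  coefficient, have on the axes a controlled number of zeros, and a prime dividing all the resulting
  numbers divides all \<open>c\<^sub>i d\<^sub>j - 1\<close>, which the lattice condition excludes.
\<close>

section \<open>Roots of polynomials in a pencil\<close>

text \<open>Split off the linear factor at a root \<open>a\<close>. Since the derivative does not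
  vanish at \<open>a\<close>, neither does the cofactor, so \<open>a\<close> adds exactly one new
  root.\<close>

lemma card_roots_simple:
  fixes p :: "'a::alg_closed_field poly"
  assumes "p \<noteq> 0" "\<And>z. poly p z = 0 \<Longrightarrow> poly (pderiv p) z \<noteq> 0"
  shows "card {z. poly p z = 0} = degree p"
  using assms
proof (induction "degree p" arbitrary: p)
  case 0
  then obtain c where "p = [:c:]" "c \<noteq> 0" by (metis degree_eq_zeroE pCons_0_0)
  then show ?case by simp
next
  case (Suc n)
  obtain a where a: "poly p a = 0" using Suc.hyps(2) alg_closed_imp_poly_has_root[of p] by auto
  then obtain q where q: "p = [:-a, 1:] * q" by (auto simp: poly_eq_0_iff_dvd)
  have q0: "q \<noteq> 0" using q Suc.prems by auto
  have "degree p = degree [:-a, 1:] + degree q" unfolding q using q0 by (subst degree_mult_eq) auto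
  then have dq: "degree q = n" using Suc.hyps(2) by simp
  have pd: "poly (pderiv p) z = poly q z + (z - a) * poly (pderiv q) z" for z
    unfolding q by (simp only: pderiv_mult poly_add poly_mult) (simp add: pderiv_pCons)
  have qa: "poly q a \<noteq> 0" using Suc.prems(2)[OF a] pd by simp
  have "poly (pderiv q) z \<noteq> 0" if "poly q z = 0" for z
    using Suc.prems(2)[of z] pd[of z] that q by auto
  then have "card {z. poly q z = 0} = n" using Suc.hyps(1)[of q] dq q0 by auto
  moreover have "{z. poly p z = 0} = insert a {z. poly q z = 0}" using q by auto
  ultimately show ?case using qa poly_roots_finite[OF q0] Suc.hyps(2) by simp
qed

text \<open>A multiple root \<open>z\<close> of a pencil member is not a zero of \<open>w\<close>,
  is a zero of the Wronskian of \<open>u\<close> and \<open>w\<close>, and determines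
  \<open>b\<close> as -u(z)/w(z). Hence a nonzero Wronskian leaves only finitely many bad
  \<open>b\<close>.\<close>

lemma finite_bad_pencil_parameters:
  fixes u w :: "'a::{field_char_0, alg_closed_field} poly"
  assumes coprime: "\<And>z. poly w z = 0 \<Longrightarrow> poly u z \<noteq> 0" and deg: "degree u < degree w"
  shows "finite {b. card {z. poly (u + smult b w) z = 0} \<noteq> degree w}"
proof -
  define W where "W = pderiv u * w - u * pderiv w"
  have w0: "w \<noteq> 0" and dw0: "pderiv w \<noteq> 0" using deg by (auto simp: pderiv_eq_0_iff)
  obtain a where a: "poly w a = 0" using deg alg_closed_imp_poly_has_root[of w] by auto
  have u0: "u \<noteq> 0" using coprime[OF a] by auto
  \<comment> \<open>Compare orders at a root \<open>a\<close> of \<open>w\<close>: in characteristic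
    zero \<open>pderiv w\<close> vanishes there to one order less than \<open>w\<close>, and
    \<open>u\<close> does not vanish, so \<open>pderiv u * w\<close> and \<open>u * pderiv w\<close>
    differ.\<close>
  have "W \<noteq> 0"
  proof
    assume "W = 0"
    then have eq: "pderiv u * w = u * pderiv w" by (simp add: W_def)
    moreover have "u * pderiv w \<noteq> 0" using u0 dw0 by simp
    ultimately have "Polynomial.order a (pderiv u) + Polynomial.order a w =
        Polynomial.order a u + Polynomial.order a (pderiv w)"
      by (metis order_mult)
    moreover have "Polynomial.order a u = 0" using coprime[OF a] by (simp add: order_0I)
    moreover have "Polynomial.order a w = Suc (Polynomial.order a (pderiv w))"
      using a w0 dw0 by (intro order_pderiv) (auto simp: order_root)
    ultimately show False by simp
  qed
  \<comment> \<open>The value 0 is excluded as well, so that \<open>w\<close> supplies the leading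
    term of the pencil member.\<close>
  then have "finite (insert 0 ((\<lambda>z. - poly u z / poly w z) ` {z. poly W z = 0}))"
    by (simp add: poly_roots_finite)
  moreover have "card {z. poly (u + smult b w) z = 0} = degree w"
    if b: "b \<notin> insert 0 ((\<lambda>z. - poly u z / poly w z) ` {z. poly W z = 0})" for b
  proof -
    have db: "degree (u + smult b w) = degree w"
      using deg b by (subst degree_add_eq_right) auto
    have "poly (pderiv (u + smult b w)) z \<noteq> 0" if z: "poly (u + smult b w) z = 0" for z
    proof
      assume z': "poly (pderiv (u + smult b w)) z = 0"
      have uz: "poly u z = - b * poly w z" using z by (simp add: eq_neg_iff_add_eq_0)
      then have wz: "poly w z \<noteq> 0" using coprime by force
      have "poly (pderiv u) z = - b * poly (pderiv w) z"
        using z' by (simp add: pderiv_add pderiv_smult eq_neg_iff_add_eq_0)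
      then have "poly W z = 0" using uz by (simp add: W_def)
      moreover have "b = - poly u z / poly w z" using uz wz by simp
      ultimately show False using b by blast
    qed
    moreover have "u + smult b w \<noteq> 0" using db deg by auto
    ultimately show ?thesis using card_roots_simple db by metis
  qed
  ultimately show ?thesis by (elim finite_subset[rotated]) blast
qed

lemma poly_surj_if_nonconst:
  fixes p :: "'a::alg_closed_field poly"
  assumes "poly p s \<noteq> poly p t"
  shows "\<exists>z. poly p z = e"
proof -
  have "degree p > 0"
    using assms by (auto elim!: degree_eq_zeroE intro!: gr0I)
  then have "degree (p - [:e:]) > 0" by (simp add: diff_conv_add_uminus degree_add_eq_left)
  then show ?thesis using alg_closed_imp_poly_has_root[of "p - [:e:]"] by auto
qed

section \<open>Groups generated by shears\<close>

text \<open>Words in the shears with the outermost shear split off, which is the shape that rule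
  induction exploits. Inverses come for free, since negating the coefficient inverts a
  shear.\<close>

inductive_set shear_group :: "nat set \<Rightarrow> nat set \<Rightarrow> ('a::comm_ring_1 \<times> 'a \<Rightarrow> 'a \<times> 'a) set"
  for C D where
  id: "id \<in> shear_group C D"
| H: "c \<in> C \<Longrightarrow> h \<in> H c \<Longrightarrow> g \<in> shear_group C D \<Longrightarrow> h \<circ> g \<in> shear_group C D"
| K: "d \<in> D \<Longrightarrow> h \<in> K d \<Longrightarrow> g \<in> shear_group C D \<Longrightarrow> h \<circ> g \<in> shear_group C D"

lemma shear_group_comp:
  "f \<in> shear_group C D \<Longrightarrow> g \<in> shear_group C D \<Longrightarrow> f \<circ> g \<in> shear_group C D"
  by (induction rule: shear_group.induct) (auto simp: comp_assoc intro: shear_group.intros)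

lemma shear_group_HI: "c \<in> C \<Longrightarrow> (\<lambda>(x, y). (x + \<alpha> * y ^ c, y)) \<in> shear_group C D"
  using shear_group.H[OF _ _ shear_group.id, of c C "\<lambda>(x, y). (x + \<alpha> * y ^ c, y)" D]
  by (auto simp: H_def)

lemma shear_group_KI: "d \<in> D \<Longrightarrow> (\<lambda>(x, y). (x, y + \<beta> * x ^ d)) \<in> shear_group C D"
  using shear_group.K[OF _ _ shear_group.id, of d D "\<lambda>(x, y). (x, y + \<beta> * x ^ d)" C]
  by (auto simp: K_def)

lemma shear_group_inverse:
  assumes "g \<in> shear_group C D"
  obtains g' where "g' \<in> shear_group C D" "\<And>p. g' (g p) = p" "\<And>p. g (g' p) = p"
proof -
  have "\<exists>g'\<in>shear_group C D. g' \<circ> g = id \<and> g \<circ> g' = id"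
    using assms
  proof (induction rule: shear_group.induct)
    case id
    show ?case by (rule bexI[OF _ shear_group.id]) simp
  next
    case (H c h g)
    then obtain \<alpha> where h: "h = (\<lambda>(x, y). (x + \<alpha> * y ^ c, y))" by (auto simp: H_def)
    obtain g' where g': "g' \<in> shear_group C D" "\<And>p. g' (g p) = p" "\<And>p. g (g' p) = p"
      using H.IH by (metis comp_apply id_apply)
    show ?case
      by (rule bexI[OF _ shear_group_comp[OF g'(1) shear_group_HI[OF H.hyps(1), of "- \<alpha>"]]])
        (auto simp: h g' fun_eq_iff split: prod.splits, (metis g'(2))+)
  next
    case (K d h g)
    then obtain \<beta> where h: "h = (\<lambda>(x, y). (x, y + \<beta> * x ^ d))" by (auto simp: K_def)
    obtain g' where g': "g' \<in> shear_group C D" "\<And>p. g' (g p) = p" "\<And>p. g (g' p) = p"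
      using K.IH by (metis comp_apply id_apply)
    show ?case
      by (rule bexI[OF _ shear_group_comp[OF g'(1) shear_group_KI[OF K.hyps(1), of "- \<beta>"]]])
        (auto simp: h g' fun_eq_iff split: prod.splits, (metis g'(2))+)
  qed
  then show ?thesis using that by (auto simp: fun_eq_iff)
qed

text \<open>Conjugation by the swap exchanges the two kinds of shears; it carries results about the
  axis \<open>y = 0\<close> over to the axis \<open>x = 0\<close>.\<close>

lemma shear_group_swap:
  "g \<in> shear_group C D \<Longrightarrow> prod.swap \<circ> g \<circ> prod.swap \<in> shear_group D C"
proof (induction rule: shear_group.induct)
  case id
  show ?case using shear_group.id by (simp add: comp_def id_def[symmetric])
next
  case (H c h g)
  then obtain \<alpha> where h: "h = (\<lambda>(x, y). (x + \<alpha> * y ^ c, y))" by (auto simp: H_def)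
  have "prod.swap \<circ> (h \<circ> g) \<circ> prod.swap =
      (\<lambda>(x, y). (x, y + \<alpha> * x ^ c)) \<circ> (prod.swap \<circ> g \<circ> prod.swap)"
    by (auto simp: h fun_eq_iff split: prod.splits)
  then show ?case using shear_group_comp[OF shear_group_KI[OF H.hyps(1)] H.IH] by (simp only:)
next
  case (K d h g)
  then obtain \<beta> where h: "h = (\<lambda>(x, y). (x, y + \<beta> * x ^ d))" by (auto simp: K_def)
  have "prod.swap \<circ> (h \<circ> g) \<circ> prod.swap =
      (\<lambda>(x, y). (x + \<beta> * y ^ d, y)) \<circ> (prod.swap \<circ> g \<circ> prod.swap)"
    by (auto simp: h fun_eq_iff split: prod.splits)
  then show ?case using shear_group_comp[OF shear_group_HI[OF K.hyps(1)] K.IH] by (simp only:)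
qed

text \<open>Reduces the behaviour of a coordinate along a curve to a polynomial in one variable,
  where algebraic closedness applies.\<close>

lemma shear_group_polynomial_curve:
  "g \<in> shear_group C D \<Longrightarrow> \<exists>a' b'. \<forall>t. g (poly a t, poly b t) = (poly a' t, poly b' t)"
proof (induction rule: shear_group.induct)
  case id
  then show ?case by auto
next
  case (H c h g)
  then obtain \<alpha> a' b' where h: "h = (\<lambda>(x, y). (x + \<alpha> * y ^ c, y))"
    and "\<forall>t. g (poly a t, poly b t) = (poly a' t, poly b' t)" by (auto simp: H_def)
  then show ?case by (intro exI[of _ "a' + smult \<alpha> (b' ^ c)"] exI[of _ b']) simp
next
  case (K d h g)
  then obtain \<beta> a' b' where h: "h = (\<lambda>(x, y). (x, y + \<beta> * x ^ d))"
    and "\<forall>t. g (poly a t, poly b t) = (poly a' t, poly b' t)" by (auto simp: K_def)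
  then show ?case by (intro exI[of _ a'] exI[of _ "b' + smult \<beta> (a' ^ d)"]) simp
qed

section \<open>Coordinates\<close>

definition coords :: "nat set \<Rightarrow> nat set \<Rightarrow> ('a::comm_ring_1 \<times> 'a \<Rightarrow> 'a) set"
  where "coords C D = {f \<circ> g | f g. f \<in> {fst, snd} \<and> g \<in> shear_group C D}"

lemma coordsI:
  "g \<in> shear_group C D \<Longrightarrow> (\<lambda>p. fst (g p)) \<in> coords C D"
  "g \<in> shear_group C D \<Longrightarrow> (\<lambda>p. snd (g p)) \<in> coords C D"
  unfolding coords_def comp_def by blast+

lemma coordsE:
  assumes "F \<in> coords C D"
  obtains (fst) g where "g \<in> shear_group C D" "F = (\<lambda>p. fst (g p))"
  | (snd) g where "g \<in> shear_group C D" "F = (\<lambda>p. snd (g p))"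
proof -
  obtain f g where "f \<in> {fst, snd}" "g \<in> shear_group C D" "F = (\<lambda>p. f (g p))"
    using assms unfolding coords_def comp_def by blast
  then show ?thesis using that by auto
qed

lemma fst_in_coords: "fst \<in> coords C D" and snd_in_coords: "snd \<in> coords C D"
  using coordsI[OF shear_group.id] by simp_all

lemma coords_comp: "F \<in> coords C D \<Longrightarrow> g \<in> shear_group C D \<Longrightarrow> (\<lambda>p. F (g p)) \<in> coords C D"
  using coordsI[OF shear_group_comp[of _ C D g]] by (auto elim!: coordsE)

lemma coords_swap: "F \<in> coords C D \<Longrightarrow> (\<lambda>p. F (prod.swap p)) \<in> coords D C"
proof (erule coordsE)
  fix g :: "'a \<times> 'a \<Rightarrow> 'a \<times> 'a"
  assume g: "g \<in> shear_group C D" "F = (\<lambda>p. fst (g p))"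
  show "(\<lambda>p. F (prod.swap p)) \<in> coords D C"
    using coordsI(2)[OF shear_group_swap[OF g(1)]] by (simp add: g(2))
next
  fix g :: "'a \<times> 'a \<Rightarrow> 'a \<times> 'a"
  assume g: "g \<in> shear_group C D" "F = (\<lambda>p. snd (g p))"
  show "(\<lambda>p. F (prod.swap p)) \<in> coords D C"
    using coordsI(1)[OF shear_group_swap[OF g(1)]] by (simp add: g(2))
qed

lemma shear_group_fixes_0:
  fixes g :: "'a::comm_ring_1 \<times> 'a \<Rightarrow> 'a \<times> 'a"
  assumes "g \<in> shear_group C D" "0 \<notin> C" "0 \<notin> D"
  shows "g (0, 0) = (0, 0)"
  using assms(1)
proof (induction rule: shear_group.induct)
  case (H c h g)
  moreover have "c \<noteq> 0" using H.hyps assms by metis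
  ultimately show ?case by (auto simp: H_def power_0_left)
next
  case (K d h g)
  moreover have "d \<noteq> 0" using K.hyps assms by metis
  ultimately show ?case by (auto simp: K_def power_0_left)
qed auto

section \<open>Coordinates with a prescribed number of zeros on an axis\<close>

abbreviation poly_X :: "'a::comm_ring_1 poly" where "poly_X \<equiv> [:0, 1:]"

lemma degree_X_power_mult:
  fixes p :: "'a::idom poly"
  assumes "p \<noteq> 0"
  shows "degree (poly_X ^ n * p) = n + degree p"
  using assms by (simp add: degree_mult_eq degree_power_eq)

text \<open>Apply \<open>K d\<close> and \<open>H c\<close> alternately, with coefficient 1, to the
  line \<open>(t, 0)\<close>. Each shear adds a power of higher degree than the component it is
  added to, so a round multiplies the degrees by \<open>c * d\<close>; the strict bound on the
  second degree keeps this going. The first component keeps a simple zero at 0.\<close>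

lemma shear_group_zigzag:
  fixes C D :: "nat set"
  assumes c: "c \<in> C" "c > 0" and d: "d \<in> D" "d > 0" and cd: "c * d \<ge> 2"
  shows "\<exists>g \<in> shear_group C D. \<exists>u v :: 'a::{field_char_0, alg_closed_field} poly.
    (\<forall>t. g (t, 0) = (t * poly u t, t ^ d * poly v t)) \<and> poly u 0 \<noteq> 0 \<and>
    degree (poly_X * u) = (c * d) ^ l \<and> degree (poly_X ^ d * v) < d * (c * d) ^ l"
proof (induction l)
  case 0
  show ?case
    by (rule bexI[OF _ shear_group.id], rule exI[of _ 1], rule exI[of _ 0]) (auto simp: d)
next
  case (Suc l)
  define q where "q = (c * d) ^ l"
  have q: "q \<ge> 1" using c d by (simp add: q_def)
  obtain g and u v :: "'a poly" where g: "g \<in> shear_group C D"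
    and g_eq: "\<And>t. g (t, 0) = (t * poly u t, t ^ d * poly v t)" and u0: "poly u 0 \<noteq> 0"
    and du: "degree (poly_X * u) = q" and dv: "degree (poly_X ^ d * v) < d * q"
    using Suc unfolding q_def by blast
  have xu: "poly_X * u \<noteq> 0" using u0 by auto
  have split: "d * c = Suc (d * c - 1)" using c d by simp
  define v' where "v' = v + u ^ d"
  define u' where "u' = u + poly_X ^ (d * c - 1) * v' ^ c"
  have xv': "poly_X ^ d * v' = poly_X ^ d * v + (poly_X * u) ^ d"
    by (simp only: v'_def power_mult_distrib distrib_left)
  have xu': "poly_X * u' = poly_X * u + (poly_X ^ d * v') ^ c"
    unfolding u'_def power_mult_distrib power_mult[symmetric] distrib_left
    by (subst split) (simp only: power_Suc mult.assoc diff_Suc_1)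
  have dv': "degree (poly_X ^ d * v') = d * q"
    using degree_add_eq_right[of "poly_X ^ d * v" "(poly_X * u) ^ d"] dv
    by (simp only: xv' degree_power_eq[OF xu] du)
  have xv0: "poly_X ^ d * v' \<noteq> 0" using dv' d q by auto
  have "q < c * (d * q)" using cd q by (simp add: mult.assoc[symmetric])
  then have "degree (poly_X * u') = c * (d * q)"
    using degree_add_eq_right[of "poly_X * u" "(poly_X ^ d * v') ^ c"]
    by (simp only: xu' degree_power_eq[OF xv0] du dv')
  then have du': "degree (poly_X * u') = (c * d) ^ Suc l" by (simp only: q_def power_Suc mult.assoc)
  have u'0: "poly u' 0 \<noteq> 0"
    using cd u0 by (simp add: u'_def power_0_left mult.commute)
  have "(\<lambda>(x, y). (x + 1 * y ^ c, y)) \<circ> ((\<lambda>(x, y). (x, y + 1 * x ^ d)) \<circ> g) \<in> shear_group C D"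
    by (intro shear_group_comp shear_group_HI shear_group_KI c d g)
  moreover have "((\<lambda>(x, y). (x + 1 * y ^ c, y)) \<circ> ((\<lambda>(x, y). (x, y + 1 * x ^ d)) \<circ> g)) (t, 0)
      = (t * poly u' t, t ^ d * poly v' t)" for t
  proof -
    have "t ^ d * poly v t + (t * poly u t) ^ d = t ^ d * poly v' t"
      by (simp add: v'_def power_mult_distrib algebra_simps)
    moreover have "t * poly u t + (t ^ d * poly v' t) ^ c = t * poly u' t"
      using arg_cong[OF xu', of "\<lambda>p. poly p t"] by simp
    ultimately show ?thesis by (simp add: g_eq)
  qed
  moreover have "degree (poly_X ^ d * v') < d * (c * d) ^ Suc l"
    using dv' \<open>q < c * (d * q)\<close> d by (simp add: q_def mult.assoc)
  ultimately show ?case using u'0 du' by blast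
qed

text \<open>One more value of \<open>b\<close> is avoided, the one that makes 0 a root. If
  \<open>w\<close> vanishes at 0 there is no such value, as \<open>u\<close> does not vanish
  there.\<close>

lemma generic_pencil:
  fixes u w :: "'a::{field_char_0, alg_closed_field} poly"
  assumes "\<And>z. poly w z = 0 \<Longrightarrow> poly u z \<noteq> 0" "degree u < degree w"
  obtains b where "card {t. t \<noteq> 0 \<and> poly (u + smult b w) t = 0} = degree w"
proof -
  define B where "B = {b. card {z. poly (u + smult b w) z = 0} \<noteq> degree w} \<union> {- poly u 0 / poly w 0}"
  have "finite B" using finite_bad_pencil_parameters[OF assms] by (simp add: B_def)
  then obtain b where b: "b \<notin> B" using ex_new_if_finite infinite_UNIV_char_0 by blast
  have "poly (u + smult b w) 0 \<noteq> 0"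
  proof
    assume z: "poly (u + smult b w) 0 = 0"
    then have "poly w 0 \<noteq> 0" using assms(1)[of 0] by auto
    then have "b = - poly u 0 / poly w 0"
      using z by (simp add: field_simps eq_neg_iff_add_eq_0)
    then show False using b by (simp add: B_def)
  qed
  then have "{t. t \<noteq> 0 \<and> poly (u + smult b w) t = 0} = {z. poly (u + smult b w) z = 0}" by auto
  then show ?thesis using b that[of b] by (simp add: B_def)
qed

lemma shear_group_eq_0_iff:
  assumes "g \<in> shear_group C D" "0 \<notin> C" "0 \<notin> D"
  shows "g p = (0, 0) \<longleftrightarrow> p = (0, 0)"
proof -
  obtain g' where "g' \<in> shear_group C D" "\<And>p. g' (g p) = p" "\<And>p. g (g' p) = p"
    using shear_group_inverse[OF assms(1)] by blast
  then show ?thesis using shear_group_fixes_0[OF assms] by metis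
qed

context
  fixes C D :: "nat set" and c d :: nat
  assumes pos: "0 \<notin> C" "0 \<notin> D" and c: "c \<in> C" and d: "d \<in> D" and cd: "c * d \<ge> 2"
begin

text \<open>After \<open>l\<close> rounds and one more \<open>K d\<close>, apply \<open>H c'\<close>
  with a generic coefficient \<open>b\<close>. On the axis the first coordinate is \<open>t\<close>
  times a member of the pencil of \<open>u\<close> and \<open>w\<close>, where \<open>w\<close> has
  degree \<open>c' * d * q - 1\<close>; the factor \<open>t\<close> contributes only the discarded
  zero.\<close>

lemma coords_card_zeros_fst:
  assumes c': "c' \<in> C" and c'd: "c' * d \<ge> 2"
  shows "\<exists>E \<in> coords C D. card {t :: 'a::{field_char_0, alg_closed_field}. t \<noteq> 0 \<and> E (t, 0) = 0}
    = c' * d * (c * d) ^ l - 1"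
proof -
  have p: "c > 0" "d > 0" "c' > 0" using pos c d c' by (metis gr0I)+
  define q where "q = (c * d) ^ l"
  have q: "q \<ge> 1" using p by (simp add: q_def)
  obtain g and u v :: "'a poly" where g: "g \<in> shear_group C D"
    and g_eq: "\<And>t. g (t, 0) = (t * poly u t, t ^ d * poly v t)" and u0: "poly u 0 \<noteq> 0"
    and du: "degree (poly_X * u) = q" and dv: "degree (poly_X ^ d * v) < d * q"
    using shear_group_zigzag[OF c p(1) d p(2) cd] unfolding q_def by blast
  define v' where "v' = v + u ^ d"
  have xu: "poly_X * u \<noteq> 0" using u0 by auto
  have xv': "poly_X ^ d * v' = poly_X ^ d * v + (poly_X * u) ^ d"
    by (simp only: v'_def power_mult_distrib distrib_left)
  have dv': "degree (poly_X ^ d * v') = d * q"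
    using degree_add_eq_right[of "poly_X ^ d * v" "(poly_X * u) ^ d"] dv
    by (simp only: xv' degree_power_eq[OF xu] du)
  then have xv0: "poly_X ^ d * v' \<noteq> 0" using p q by auto
  define h where "h = (\<lambda>(x, y). (x, y + 1 * x ^ d)) \<circ> g"
  have h: "h \<in> shear_group C D"
    unfolding h_def by (intro shear_group_comp shear_group_KI d g)
  have h_eq: "h (t, 0) = (t * poly u t, t ^ d * poly v' t)" for t
    by (simp add: h_def g_eq v'_def power_mult_distrib algebra_simps)
  define w where "w = poly_X ^ (d * c' - 1) * v' ^ c'"
  have split: "d * c' = Suc (d * c' - 1)" using p by simp
  have xw: "poly_X * w = (poly_X ^ d * v') ^ c'"
    unfolding w_def power_mult_distrib power_mult[symmetric]
    by (subst split) (simp only: power_Suc mult.assoc diff_Suc_1)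
  have "w \<noteq> 0" using xv0 by (auto simp: w_def)
  then have "Suc (degree w) = degree (poly_X * w)" using degree_X_power_mult[of w 1] by simp
  also have "\<dots> = c' * d * q" unfolding xw degree_power_eq[OF xv0] dv' by simp
  finally have dw: "degree w = c' * d * q - 1" by simp
  have "Suc (degree u) = q" using degree_X_power_mult[of u 1] xu du by auto
  moreover have "2 * q \<le> c' * d * q" using c'd by (rule mult_le_mono1)
  ultimately have "degree u < degree w" using q dw by linarith
  \<comment> \<open>At a common zero \<open>z \<noteq> 0\<close> the word \<open>h\<close> would
    send \<open>(z, 0)\<close> to the origin, which only the origin itself reaches.\<close>
  moreover have "poly u z \<noteq> 0" if "poly w z = 0" for z
  proof (cases "z = 0")
    case False
    then have "poly v' z = 0" using that by (auto simp: w_def)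
    then show ?thesis using h_eq[of z] shear_group_eq_0_iff[OF h pos, of "(z, 0)"] False by auto
  qed (use u0 in simp)
  ultimately obtain b where b: "card {t. t \<noteq> 0 \<and> poly (u + smult b w) t = 0} = degree w"
    using generic_pencil by blast
  have eq: "fst (((\<lambda>(x, y). (x + b * y ^ c', y)) \<circ> h) (t, 0)) = t * poly (u + smult b w) t" for t
    using arg_cong[OF xw, of "\<lambda>p. poly p t"] by (simp add: h_eq algebra_simps)
  have "{t. t \<noteq> 0 \<and> fst (((\<lambda>(x, y). (x + b * y ^ c', y)) \<circ> h) (t, 0)) = 0}
      = {t. t \<noteq> 0 \<and> poly (u + smult b w) t = 0}"
    by (simp only: eq) auto
  then show ?thesis
    by (intro bexI[OF _ coordsI(1)[OF shear_group_comp[OF shear_group_HI[OF c', of b] h]]])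
      (simp only: b dw q_def)
qed

text \<open>Now the last shear is \<open>K d\<close> with a generic coefficient, and the second
  coordinate is \<open>t ^ d\<close> times a member of the pencil of \<open>v\<close> and
  \<open>u ^ d\<close>. Taking \<open>l > 0\<close> makes \<open>u\<close> nonconstant.\<close>

lemma coords_card_zeros_snd:
  assumes l: "l > 0"
  shows "\<exists>E \<in> coords C D. card {t :: 'a::{field_char_0, alg_closed_field}. t \<noteq> 0 \<and> E (t, 0) = 0}
    = d * ((c * d) ^ l - 1)"
proof -
  have p: "c > 0" "d > 0" using pos c d by (metis gr0I)+
  define q where "q = (c * d) ^ l"
  have "c * d \<le> q" unfolding q_def using p l by (intro self_le_power) auto
  then have q: "q \<ge> 2" using cd by simp
  obtain g and u v :: "'a poly" where g: "g \<in> shear_group C D"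
    and g_eq: "\<And>t. g (t, 0) = (t * poly u t, t ^ d * poly v t)" and u0: "poly u 0 \<noteq> 0"
    and du: "degree (poly_X * u) = q" and dv: "degree (poly_X ^ d * v) < d * q"
    using shear_group_zigzag[OF c p(1) d p(2) cd] unfolding q_def by blast
  have "u \<noteq> 0" using u0 by auto
  then have du': "degree u = q - 1" using degree_X_power_mult[of u 1] du by simp
  have dud: "degree (u ^ d) = d * (q - 1)" using \<open>u \<noteq> 0\<close> du' by (simp add: degree_power_eq)
  have "degree v < degree (u ^ d)"
  proof (cases "v = 0")
    case True
    then show ?thesis using p q dud by simp
  next
    case False
    then have "d + degree v < d * q" using dv by (simp add: degree_X_power_mult)
    then show ?thesis unfolding dud by (simp add: right_diff_distrib')
  qed
  moreover have "poly v z \<noteq> 0" if "poly (u ^ d) z = 0" for z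
  proof -
    have "poly u z = 0" using that p by auto
    moreover from this have "z \<noteq> 0" using u0 by auto
    ultimately show ?thesis
      using g_eq[of z] shear_group_eq_0_iff[OF g pos, of "(z, 0)"] by auto
  qed
  ultimately obtain b where b: "card {t. t \<noteq> 0 \<and> poly (v + smult b (u ^ d)) t = 0} = d * (q - 1)"
    using generic_pencil[of "u ^ d" v] unfolding dud by blast
  have "snd (((\<lambda>(x, y). (x, y + b * x ^ d)) \<circ> g) (t, 0)) = t ^ d * poly (v + smult b (u ^ d)) t" for t
    by (simp add: g_eq power_mult_distrib algebra_simps)
  then have "{t. t \<noteq> 0 \<and> snd (((\<lambda>(x, y). (x, y + b * x ^ d)) \<circ> g) (t, 0)) = 0}
      = {t. t \<noteq> 0 \<and> poly (v + smult b (u ^ d)) t = 0}"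
    using p by auto
  then show ?thesis
    by (intro bexI[OF _ coordsI(2)[OF shear_group_comp[OF shear_group_KI[OF d, of b] g]]])
      (simp only: b q_def)
qed

end

section \<open>Level curves of coordinates\<close>

locale positive_shears =
  fixes C D :: "nat set" and G :: "('a::{field_char_0, alg_closed_field} \<times> 'a \<Rightarrow> 'a \<times> 'a) set"
  assumes G_eq: "G = shear_group C D"
    and pos: "0 \<notin> C" "0 \<notin> D" and nonempty: "C \<noteq> {}" "D \<noteq> {}"
begin

lemma id_in_G: "id \<in> G"
  unfolding G_eq by (rule shear_group.id)

lemma comp_in_G: "f \<in> G \<Longrightarrow> g \<in> G \<Longrightarrow> (\<lambda>p. f (g p)) \<in> G"
  using shear_group_comp[of f C D g] by (simp add: G_eq comp_def)

lemma inverse_in_G: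
  assumes "g \<in> G"
  obtains g' where "g' \<in> G" "\<And>p. g' (g p) = p" "\<And>p. g (g' p) = p"
  using shear_group_inverse[of g C D] assms that unfolding G_eq by metis

lemma inj_G:
  assumes "g \<in> G"
  shows "g p = g q \<longleftrightarrow> p = q"
proof -
  obtain g' where "g' \<in> G" "\<And>p. g' (g p) = p" "\<And>p. g (g' p) = p" using inverse_in_G[OF assms] by blast
  then show ?thesis by metis
qed

lemma G_eq_0_iff: "g \<in> G \<Longrightarrow> g p = (0, 0) \<longleftrightarrow> p = (0, 0)"
  using shear_group_eq_0_iff[OF _ pos] unfolding G_eq by blast

abbreviation FF :: "('a \<times> 'a \<Rightarrow> 'a) set" where "FF \<equiv> coords C D"

lemma FF_comp: "F \<in> FF \<Longrightarrow> g \<in> G \<Longrightarrow> (\<lambda>p. F (g p)) \<in> FF"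
  unfolding G_eq by (rule coords_comp)

lemma FF_cases:
  assumes "F \<in> FF"
  obtains (fst) g where "g \<in> G" "F = (\<lambda>p. fst (g p))"
  | (snd) g where "g \<in> G" "F = (\<lambda>p. snd (g p))"
  using assms unfolding G_eq by (rule coordsE)

text \<open>The inverse of \<open>g\<close> carries a line parallel to an axis onto the level curve,
  polynomially and injectively.\<close>

lemma level_parametrization:
  assumes "F \<in> FF"
  shows "\<exists>a b. {p. F p = u} = range (\<lambda>t. (poly a t, poly b t)) \<and> inj (\<lambda>t. (poly a t, poly b t))"
  using assms
proof (cases rule: FF_cases)
  case (fst g)
  obtain g' where g': "g' \<in> G" "\<And>p. g' (g p) = p" "\<And>p. g (g' p) = p"
    using inverse_in_G[OF fst(1)] by blast
  obtain a b where "\<forall>t. g' (poly [:u:] t, poly [:0, 1:] t) = (poly a t, poly b t)"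
    using shear_group_polynomial_curve g'(1) unfolding G_eq by blast
  then have ab: "(\<lambda>t. (poly a t, poly b t)) = (\<lambda>t. g' (u, t))" by simp
  have "p \<in> range (\<lambda>t. g' (u, t))" if "F p = u" for p
  proof -
    have "g p = (u, snd (g p))" using that by (simp add: fst(2) prod_eq_iff)
    then show ?thesis using g'(2)[of p] by (metis rangeI)
  qed
  then have "{p. F p = u} = range (\<lambda>t. g' (u, t))" by (auto simp: fst(2) g'(3))
  moreover have "inj (\<lambda>t. g' (u, t))" by (rule injI) (simp add: inj_G[OF g'(1)])
  ultimately show ?thesis unfolding ab[symmetric] by blast
next
  case (snd g)
  obtain g' where g': "g' \<in> G" "\<And>p. g' (g p) = p" "\<And>p. g (g' p) = p"
    using inverse_in_G[OF snd(1)] by blast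
  obtain a b where "\<forall>t. g' (poly [:0, 1:] t, poly [:u:] t) = (poly a t, poly b t)"
    using shear_group_polynomial_curve g'(1) unfolding G_eq by blast
  then have ab: "(\<lambda>t. (poly a t, poly b t)) = (\<lambda>t. g' (t, u))" by simp
  have "p \<in> range (\<lambda>t. g' (t, u))" if "F p = u" for p
  proof -
    have "g p = (fst (g p), u)" using that by (simp add: snd(2) prod_eq_iff)
    then show ?thesis using g'(2)[of p] by (metis rangeI)
  qed
  then have "{p. F p = u} = range (\<lambda>t. g' (t, u))" by (auto simp: snd(2) g'(3))
  moreover have "inj (\<lambda>t. g' (t, u))" by (rule injI) (simp add: inj_G[OF g'(1)])
  ultimately show ?thesis unfolding ab[symmetric] by blast
qed

lemma coord_along_curve:
  assumes "E \<in> FF"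
  shows "\<exists>e. \<forall>t. E (poly a t, poly b t) = poly e t"
  using assms
proof (cases rule: FF_cases)
  case (fst g)
  obtain x y where "\<forall>t. g (poly a t, poly b t) = (poly x t, poly y t)"
    using shear_group_polynomial_curve fst(1) unfolding G_eq by blast
  then show ?thesis by (auto simp: fst(2))
next
  case (snd g)
  obtain x y where "\<forall>t. g (poly a t, poly b t) = (poly x t, poly y t)"
    using shear_group_polynomial_curve snd(1) unfolding G_eq by blast
  then show ?thesis by (auto simp: snd(2))
qed

lemma coord_surj_on_level:
  assumes "F \<in> FF" "E \<in> FF" "F p = F q" "E p \<noteq> E q"
  shows "\<exists>z. F z = F p \<and> E z = e"
proof -
  obtain a b where ab: "{z. F z = F p} = range (\<lambda>t. (poly a t, poly b t))"
    using level_parametrization[OF assms(1)] by blast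
  obtain c where c: "\<And>t. E (poly a t, poly b t) = poly c t"
    using coord_along_curve[OF assms(2)] by blast
  have "p \<in> range (\<lambda>t. (poly a t, poly b t))" "q \<in> range (\<lambda>t. (poly a t, poly b t))"
    using assms(3) unfolding ab[symmetric] by auto
  then obtain s t where "p = (poly a s, poly b s)" "q = (poly a t, poly b t)" by auto
  then obtain z where "poly c z = e"
    using poly_surj_if_nonconst assms(4) c by metis
  then have "E (poly a z, poly b z) = e" using c by simp
  moreover have "F (poly a z, poly b z) = F p" using ab by auto
  ultimately show ?thesis by blast
qed

text \<open>A coordinate embeds a curve on which it is constant into a line, and an injective
  polynomial map between lines is onto.\<close>
lemma level_eq_if_const:
  assumes "F \<in> FF" "E \<in> FF" "\<And>p. F p = u \<Longrightarrow> E p = e" "E p = e"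
  shows "F p = u"
proof -
  obtain a b where ab: "{p. F p = u} = range (\<lambda>t. (poly a t, poly b t))"
    and inj: "inj (\<lambda>t. (poly a t, poly b t))"
    using level_parametrization[OF assms(1)] by blast
  have lev: "F (poly a t, poly b t) = u" for t using ab by auto
  have E: "E (poly a t, poly b t) = e" for t using lev assms(3) by blast
  have "\<exists>t. p = (poly a t, poly b t)"
    using assms(2)
  proof (cases rule: FF_cases)
    case (fst g)
    obtain x y where xy: "\<forall>t. g (poly a t, poly b t) = (poly x t, poly y t)"
      using shear_group_polynomial_curve fst(1) unfolding G_eq by blast
    have x: "poly x t = e" for t using E[of t] xy fst(2) by simp
    have "g (poly a 0, poly b 0) \<noteq> g (poly a 1, poly b 1)"
      using inj_G[OF fst(1)] injD[OF inj, of 0 1] by auto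
    then have "poly y 0 \<noteq> poly y 1" using xy x by auto
    then obtain t where "poly y t = snd (g p)" using poly_surj_if_nonconst by blast
    then have "g p = g (poly a t, poly b t)"
      using xy x assms(4) fst(2) by (simp add: prod_eq_iff)
    then show ?thesis using inj_G[OF fst(1)] by blast
  next
    case (snd g)
    obtain x y where xy: "\<forall>t. g (poly a t, poly b t) = (poly x t, poly y t)"
      using shear_group_polynomial_curve snd(1) unfolding G_eq by blast
    have y: "poly y t = e" for t using E[of t] xy snd(2) by simp
    have "g (poly a 0, poly b 0) \<noteq> g (poly a 1, poly b 1)"
      using inj_G[OF snd(1)] injD[OF inj, of 0 1] by auto
    then have "poly x 0 \<noteq> poly x 1" using xy y by auto
    then obtain t where "poly x t = fst (g p)" using poly_surj_if_nonconst by blast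
    then have "g p = g (poly a t, poly b t)"
      using xy y assms(4) snd(2) by (simp add: prod_eq_iff)
    then show ?thesis using inj_G[OF snd(1)] by blast
  qed
  then show ?thesis using lev by blast
qed

text \<open>Were \<open>E\<close> constant on the level \<open>u\<close> of \<open>F\<close>, that
  curve would be a full level curve of \<open>E\<close>. But \<open>E\<close> also takes this value
  on the level through \<open>p\<close>, so the two levels of \<open>F\<close> would coincide, while
  \<open>E\<close> is not constant on the latter.\<close>

lemma coord_surj_on_all_levels:
  assumes "F \<in> FF" "E \<in> FF" "F p = F q" "E p \<noteq> E q"
  shows "\<exists>z. F z = u \<and> E z = e"
proof -
  obtain z0 where z0: "F z0 = u"
    using level_parametrization[OF assms(1), of u] by blast
  show ?thesis
  proof (cases "\<forall>z. F z = u \<longrightarrow> E z = E z0")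
    case True
    obtain z where z: "F z = F p" "E z = E z0"
      using coord_surj_on_level[OF assms] by blast
    then have "F p = u" using level_eq_if_const[of F E u "E z0" z] assms True by auto
    then show ?thesis using True assms by metis
  next
    case False
    then obtain z where "F z = u" "E z \<noteq> E z0" by blast
    then show ?thesis using coord_surj_on_level[of F E z z0] assms z0 by metis
  qed
qed

lemma level_orbit:
  assumes "F \<in> FF" "F z = F w" "F z \<noteq> 0"
  shows "\<exists>s\<in>G. s z = w \<and> (\<forall>p. F p = 0 \<longrightarrow> s p = p)"
  using assms(1)
proof (cases rule: FF_cases)
  case (fst g)
  obtain g' where g': "g' \<in> G" "\<And>p. g' (g p) = p" "\<And>p. g (g' p) = p"
    using inverse_in_G[OF fst(1)] by blast
  obtain d where d: "d \<in> D" using nonempty by blast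
  then have d0: "d > 0" using pos by (metis gr0I)
  \<comment> \<open>The denominator is a power of \<open>F z\<close>, which is nonzero, and the
    shear \<open>k\<close> takes \<open>g z\<close> to \<open>g w\<close>. Where \<open>F\<close>
    vanishes, \<open>k\<close> acts as the identity because \<open>d > 0\<close>.\<close>
  define \<beta> where "\<beta> = (snd (g w) - snd (g z)) / fst (g z) ^ d"
  define k where "k = (\<lambda>(x, y). (x, y + \<beta> * x ^ d))"
  have k: "k \<in> G" unfolding G_eq k_def using d by (rule shear_group_KI)
  have "k (g z) = g w"
    using assms(2,3) by (simp add: k_def fst(2) \<beta>_def prod_eq_iff case_prod_beta)
  moreover have "k (g p) = g p" if "F p = 0" for p
    using that d0 by (simp add: k_def fst(2) case_prod_beta prod_eq_iff)
  ultimately show ?thesis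
    using g' comp_in_G[OF g'(1) comp_in_G[OF k fst(1)]]
    by (intro bexI[of _ "\<lambda>p. g' (k (g p))"]) auto
next
  case (snd g)
  obtain g' where g': "g' \<in> G" "\<And>p. g' (g p) = p" "\<And>p. g (g' p) = p"
    using inverse_in_G[OF snd(1)] by blast
  obtain c where c: "c \<in> C" using nonempty by blast
  then have c0: "c > 0" using pos by (metis gr0I)
  define \<alpha> where "\<alpha> = (fst (g w) - fst (g z)) / snd (g z) ^ c"
  define h where "h = (\<lambda>(x, y). (x + \<alpha> * y ^ c, y))"
  have h: "h \<in> G" unfolding G_eq h_def using c by (rule shear_group_HI)
  have "h (g z) = g w"
    using assms(2,3) by (simp add: h_def snd(2) \<alpha>_def prod_eq_iff case_prod_beta)
  moreover have "h (g p) = g p" if "F p = 0" for p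
    using that c0 by (simp add: h_def snd(2) case_prod_beta prod_eq_iff)
  ultimately show ?thesis
    using g' comp_in_G[OF g'(1) comp_in_G[OF h snd(1)]]
    by (intro bexI[of _ "\<lambda>p. g' (h (g p))"]) auto
qed

text \<open>Both points are joined to a base point \<open>o1\<close>, where \<open>F0\<close> and
  \<open>E0\<close> equal 1, by moves along nonzero level curves of coordinates vanishing on
  \<open>P\<close>: first along the curve of \<open>F\<close> until \<open>F0\<close> is 1, then
  along that curve of \<open>F0\<close>.\<close>

lemma stabilizer_transitive:
  assumes EF: "F0 \<in> FF" "E0 \<in> FF" "\<And>p. p \<in> P \<Longrightarrow> F0 p = 0" "\<And>p. p \<in> P \<Longrightarrow> E0 p = 0"
    and nonconst: "F0 p1 = F0 p2" "E0 p1 \<noteq> E0 p2"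
    and z: "F \<in> FF" "\<And>p. p \<in> P \<Longrightarrow> F p = 0" "F z \<noteq> 0"
    and w: "F' \<in> FF" "\<And>p. p \<in> P \<Longrightarrow> F' p = 0" "F' w \<noteq> 0"
  shows "\<exists>s\<in>G. s z = w \<and> (\<forall>p\<in>P. s p = p)"
proof -
  define eqv where "eqv = (\<lambda>z w. \<exists>s\<in>G. s z = w \<and> (\<forall>p\<in>P. s p = p))"
  have trans: "eqv a c" if "eqv a b" "eqv b c" for a b c
    using that comp_in_G unfolding eqv_def by (metis (no_types, lifting))
  have sym: "eqv b a" if ab: "eqv a b" for a b
  proof -
    obtain s where s: "s \<in> G" "s a = b" "\<forall>p\<in>P. s p = p" using ab unfolding eqv_def by blast
    obtain s' where s': "s' \<in> G" "\<And>p. s' (s p) = p" "\<And>p. s (s' p) = p"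
      using inverse_in_G[OF s(1)] by blast
    then show ?thesis unfolding eqv_def using s by metis
  qed
  have level: "eqv a b" if "A \<in> FF" "\<And>p. p \<in> P \<Longrightarrow> A p = 0" "A a = A b" "A a \<noteq> 0" for A a b
    using level_orbit[OF that(1,3,4)] that(2) unfolding eqv_def by blast
  have surj: "\<exists>z. F0 z = u \<and> E0 z = e" for u e
    by (rule coord_surj_on_all_levels[OF EF(1,2) nonconst])
  obtain o1 where o1: "F0 o1 = 1" "E0 o1 = 1" using surj by blast
  have to_o1: "eqv z o1" if F: "F \<in> FF" "\<And>p. p \<in> P \<Longrightarrow> F p = 0" "F z \<noteq> 0" for F z
  proof (cases "\<forall>w. F w = F z \<longrightarrow> F0 w = F0 z")
    \<comment> \<open>The curves of \<open>F\<close> and \<open>F0\<close> through \<open>z\<close>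
      coincide. Move along this curve until \<open>E0\<close> is 1 and finish along the curve of
      \<open>E0\<close>.\<close>
    case True
    then have "F w = F z" if "F0 w = F0 z" for w
      using level_eq_if_const[OF F(1) EF(1)] that by blast
    moreover obtain w where w: "F0 w = F0 z" "E0 w = 1" using surj by blast
    ultimately have "eqv z w" using level[OF F(1,2)] F(3) by metis
    moreover have "eqv w o1" using level[OF EF(2,4)] w o1 by simp
    ultimately show ?thesis by (rule trans)
  next
    case False
    then obtain w' where "F w' = F z" "F0 w' \<noteq> F0 z" by blast
    then obtain w where "F w = F z" "F0 w = 1"
      using coord_surj_on_level[OF F(1) EF(1)] by metis
    then have "eqv z w" "eqv w o1" using level[OF F(1,2)] F(3) level[OF EF(1,3)] o1 by simp_all
    then show ?thesis by (rule trans)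
  qed
  show ?thesis using trans[OF to_o1[OF z] sym[OF to_o1[OF w]]] unfolding eqv_def .
qed

end

section \<open>Divisibility forced by set transitivity\<close>

context positive_shears
begin

text \<open>A closure operator on the punctured plane. The origin is removed because every
  coordinate vanishes there.\<close>

definition cl :: "('a \<times> 'a) set \<Rightarrow> ('a \<times> 'a) set"
  where "cl P = {z. z \<noteq> (0, 0) \<and> (\<forall>F\<in>FF. (\<forall>p\<in>P. F p = 0) \<longrightarrow> F z = 0)}"

lemma cl_superset: "(0, 0) \<notin> P \<Longrightarrow> P \<subseteq> cl P"
  by (auto simp: cl_def)

lemma zero_notin_cl: "(0, 0) \<notin> cl P"
  by (simp add: cl_def)

lemma cl_least: "Q \<subseteq> cl P \<Longrightarrow> cl Q \<subseteq> cl P"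
  unfolding cl_def by blast

text \<open>Precomposition with \<open>g\<close> permutes \<open>FF\<close>. Under set transitivity
  this makes all blocks equally large.\<close>

lemma cl_image:
  assumes "g \<in> G"
  shows "cl (g ` P) = g ` cl P"
proof -
  have sub: "g ` cl P \<subseteq> cl (g ` P)" if "g \<in> G" for g P
  proof
    fix w assume "w \<in> g ` cl P"
    then obtain z where z: "z \<in> cl P" "w = g z" by blast
    have "F w = 0" if "F \<in> FF" "\<forall>p\<in>g ` P. F p = 0" for F
      using z that FF_comp[OF that(1) \<open>g \<in> G\<close>] by (auto simp: cl_def)
    moreover have "w \<noteq> (0, 0)" using z G_eq_0_iff[OF \<open>g \<in> G\<close>] by (simp add: cl_def)
    ultimately show "w \<in> cl (g ` P)" by (simp add: cl_def)
  qed
  obtain g' where g': "g' \<in> G" "\<And>p. g' (g p) = p" "\<And>p. g (g' p) = p"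
    using inverse_in_G[OF assms] by blast
  have "g' ` cl (g ` P) \<subseteq> cl P"
    using sub[OF g'(1), of "g ` P"] by (simp add: image_image g')
  then have "cl (g ` P) \<subseteq> g ` cl P" using g'(3) by (metis image_eqI image_subset_iff subsetI)
  then show ?thesis using sub[OF assms] by blast
qed

definition common_zeros :: "('a \<times> 'a \<Rightarrow> 'a) \<Rightarrow> ('a \<times> 'a \<Rightarrow> 'a) \<Rightarrow> ('a \<times> 'a) set"
  where "common_zeros E F = {z. z \<noteq> (0, 0) \<and> E z = 0 \<and> F z = 0}"

lemma cl_common_zeros:
  assumes "E \<in> FF" "F \<in> FF"
  shows "cl (common_zeros E F) \<subseteq> common_zeros E F"
  using assms by (auto simp: cl_def common_zeros_def)

definition set_transitive :: "nat \<Rightarrow> bool"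
  where "set_transitive N \<longleftrightarrow> (\<forall>P Q. finite P \<and> finite Q \<and> card P = N \<and> card Q = N \<and>
    (0, 0) \<notin> P \<and> (0, 0) \<notin> Q \<longrightarrow> (\<exists>g\<in>G. g ` P = Q))"

text \<open>The sets \<open>cl P\<close> with \<open>card P = N\<close> are the blocks of a Steiner system: any \<open>N\<close> points lie in
  exactly one of them. So the blocks through \<open>N - 1\<close> fixed points of \<open>Z\<close> partition the rest of \<open>Z\<close>.\<close>
lemma card_block_dvd:
  assumes tr: "set_transitive N" and N: "N \<ge> 1"
    and Z: "(0, 0) \<notin> Z" "cl Z \<subseteq> Z" "card Z \<ge> N"
    and P: "(0, 0) \<notin> P" "finite P" "card P = N"
  shows "finite (cl P)" "card (cl P) - (N - 1) dvd card Z - (N - 1)"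
proof -
  have finZ: "finite Z" using Z N by (metis card.infinite not_one_le_zero order_trans)
  obtain P0 where P0: "P0 \<subseteq> Z" "card P0 = N" using Z(3) by (meson obtain_subset_with_card_n)
  then have finP0: "finite P0" "(0, 0) \<notin> P0" using finZ Z(1) finite_subset by auto
  have cl_eq: "finite (cl Q) \<and> card (cl Q) = card (cl P0)"
    if Q: "(0, 0) \<notin> Q" "finite Q" "card Q = N" for Q
  proof -
    obtain g where g: "g \<in> G" "g ` P0 = Q"
      using tr Q P0 finP0 unfolding set_transitive_def by blast
    have "cl P0 \<subseteq> Z"
      using P0(1) cl_superset[OF Z(1)] Z(2) cl_least by blast
    then have "finite (cl P0)" using finZ finite_subset by blast
    moreover have "inj_on g (cl P0)" using inj_G[OF g(1)] by (simp add: inj_on_def)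
    moreover have "cl Q = g ` cl P0" using cl_image[OF g(1)] g(2) by blast
    ultimately show ?thesis by (simp add: card_image)
  qed
  show "finite (cl P)" using cl_eq P by blast
  \<comment> \<open>\<open>cl Q\<close> lies in \<open>cl S\<close>, and both have the same finite
    cardinality.\<close>
  have exch: "cl Q = cl S"
    if "(0, 0) \<notin> S" "finite S" "card S = N" "Q \<subseteq> cl S" "card Q = N" for Q S
  proof -
    have "(0, 0) \<notin> Q" "finite Q"
      using that cl_eq[of S] zero_notin_cl finite_subset by blast+
    then show ?thesis
      using that cl_eq[of S] cl_eq[of Q] cl_least[OF that(4)] by (intro card_subset_eq) auto
  qed
  \<comment> \<open>Fix \<open>N - 1\<close> points of \<open>Z\<close>; a block through them is
    determined by any further point that it contains.\<close>
  obtain R where R: "R \<subseteq> Z" "card R = N - 1"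
    using Z(3) by (meson diff_le_self le_trans obtain_subset_with_card_n)
  have finR: "finite R" using R finZ finite_subset by blast
  define blocks where "blocks = (\<lambda>p. cl (insert p R) - R) ` (Z - R)"
  have ins: "(0, 0) \<notin> insert p R \<and> finite (insert p R) \<and> card (insert p R) = N \<and> R \<subseteq> cl (insert p R)
      \<and> p \<in> cl (insert p R)"
    if "p \<noteq> (0, 0)" "p \<notin> R" for p
  proof -
    have *: "(0, 0) \<notin> insert p R" using that R Z by auto
    then show ?thesis using that N R finR cl_superset[OF *] by auto
  qed
  have union: "\<Union> blocks = Z - R"
  proof
    show "Z - R \<subseteq> \<Union> blocks"
    proof
      fix p assume p: "p \<in> Z - R"
      then have "p \<noteq> (0, 0)" "p \<notin> R" using Z(1) by auto
      then have "p \<in> cl (insert p R) - R" using ins by blast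
      then show "p \<in> \<Union> blocks" unfolding blocks_def using p by blast
    qed
    have "cl (insert p R) \<subseteq> Z" if "p \<in> Z - R" for p
    proof -
      have "insert p R \<subseteq> cl Z" using that R cl_superset[OF Z(1)] by blast
      then show ?thesis using cl_least Z(2) by blast
    qed
    then show "\<Union> blocks \<subseteq> Z - R" unfolding blocks_def by blast
  qed
  have card_block: "card (cl (insert p R) - R) = card (cl P) - (N - 1)" if "p \<in> Z - R" for p
  proof -
    have "p \<noteq> (0, 0)" "p \<notin> R" using that Z(1) by auto
    from ins[OF this] show ?thesis
      using cl_eq[of "insert p R"] cl_eq[of P] P finR R by (simp add: card_Diff_subset)
  qed
  \<comment> \<open>A shared point \<open>x\<close> and \<open>R\<close> form \<open>N\<close>
    points lying in both blocks, so both equal \<open>cl (insert x R)\<close>.\<close>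
  have disj: "cl (insert p R) - R = cl (insert p' R) - R"
    if p: "p \<in> Z - R" "p' \<in> Z - R" and x: "x \<in> cl (insert p R) - R" "x \<in> cl (insert p' R) - R" for p p' x
  proof -
    have p0: "p \<noteq> (0, 0)" "p \<notin> R" "p' \<noteq> (0, 0)" "p' \<notin> R" using p Z(1) by auto
    have "x \<noteq> (0, 0)" "x \<notin> R" using x zero_notin_cl by auto
    note insx = ins[OF this]
    have "cl (insert x R) = cl (insert p R)"
      using x ins[OF p0(1,2)] insx by (intro exch) auto
    moreover have "cl (insert x R) = cl (insert p' R)"
      using x ins[OF p0(3,4)] insx by (intro exch) auto
    ultimately show ?thesis by simp
  qed
  have "(card (cl P) - (N - 1)) * card blocks = card (\<Union> blocks)"
  proof (rule card_partition)
    show "finite blocks" using finZ by (simp add: blocks_def)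
    show "finite (\<Union> blocks)" unfolding union using finZ by simp
    show "card B = card (cl P) - (N - 1)" if "B \<in> blocks" for B
      using that card_block unfolding blocks_def by blast
    show "B \<inter> B' = {}" if B: "B \<in> blocks" "B' \<in> blocks" "B \<noteq> B'" for B B'
    proof (rule ccontr)
      assume "B \<inter> B' \<noteq> {}"
      then obtain x where x: "x \<in> B" "x \<in> B'" by blast
      obtain p p' where "p \<in> Z - R" "B = cl (insert p R) - R" "p' \<in> Z - R" "B' = cl (insert p' R) - R"
        using B unfolding blocks_def by blast
      then show False using disj[of p p' x] x B(3) by simp
    qed
  qed
  also have "card (\<Union> blocks) = card Z - (N - 1)"
    unfolding union using R finR by (simp add: card_Diff_subset)
  finally show "card (cl P) - (N - 1) dvd card Z - (N - 1)" by (rule dvdI[OF sym])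
qed

end

text \<open>The numbers in the hypotheses are the numbers of zeros on the axes, minus \<open>N - 1\<close>.\<close>
lemma prime_dvd_block_exponents:
  fixes p q N c d :: int and L :: nat
  assumes p: "prime p" and q: "q = c * d"
    and fst: "\<And>c' l. c' \<in> C \<Longrightarrow> c' * d \<ge> 2 \<Longrightarrow> l \<ge> L \<Longrightarrow> p dvd c' * d * q ^ l - N"
    and fst': "\<And>d' l. d' \<in> D \<Longrightarrow> d' * c \<ge> 2 \<Longrightarrow> l \<ge> L \<Longrightarrow> p dvd d' * c * q ^ l - N"
    and snd: "p dvd d * (q ^ L - 1) - (N - 1)" and snd': "p dvd c * (q ^ L - 1) - (N - 1)"
    and pos: "\<And>x. x \<in> C \<Longrightarrow> x > 0" "\<And>x. x \<in> D \<Longrightarrow> x > 0"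
    and cd: "c \<in> C" "d \<in> D" "c * d \<ge> 2"
    and c'd': "c' \<in> C" "d' \<in> D"
  shows "p dvd c' * d' - 1"
proof -
  have 1: "p dvd q * q ^ L - N" "p dvd q * q ^ Suc L - N"
    using fst[OF cd(1,3), of L] fst[OF cd(1,3), of "Suc L"] q by auto
  \<comment> \<open>If \<open>p\<close> divided \<open>q\<close>, it would divide \<open>N\<close>
    and one of \<open>c\<close>, \<open>d\<close>; the count with that factor in front then makes it
    divide \<open>N - 1\<close>.\<close>
  have "\<not> p dvd q"
  proof
    assume "p dvd q"
    then have "p dvd N" using 1(1) by (metis dvd_diff_right_iff dvd_mult2)
    have np: "\<not> p dvd 1" using p not_prime_unit by blast
    have "p dvd c \<or> p dvd d" using \<open>p dvd q\<close> p q by (simp add: prime_dvd_mult_iff)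
    then obtain e where "p dvd e" "p dvd e * (q ^ L - 1) - (N - 1)" using snd snd' by blast
    then have "p dvd N - 1" by (metis dvd_diff_right_iff dvd_mult2)
    then have "p dvd N - (N - 1)" using \<open>p dvd N\<close> by (rule dvd_diff[rotated])
    then show False using np by simp
  qed
  then have nL: "\<not> p dvd q ^ l" for l using p prime_dvd_power by blast
  \<comment> \<open>Subtracting the counts for consecutive exponents eliminates \<open>N\<close> and
    leaves a power of \<open>q\<close> times \<open>q - 1\<close>.\<close>
  have "p dvd (q * q ^ Suc L - N) - (q * q ^ L - N)" using 1 by (rule dvd_diff[rotated])
  also have "\<dots> = q ^ Suc L * (q - 1)" by (simp add: algebra_simps)
  finally have q1: "p dvd q - 1" using p nL by (simp add: prime_dvd_mult_iff del: power_Suc)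
  \<comment> \<open>Comparing the counts for \<open>x\<close> and \<open>q\<close> shows that they
    agree modulo \<open>p\<close>. The value 1 is treated apart because the counts assume a product
    of at least 2.\<close>
  have key: "p dvd x - 1" if "x = 1 \<or> p dvd x * q ^ L - N" for x
  proof (cases "x = 1")
    case False
    then have "p dvd x * q ^ L - N" using that by simp
    then have "p dvd (x * q ^ L - N) - (q * q ^ L - N)" using 1(1) by (rule dvd_diff)
    also have "\<dots> = q ^ L * (x - q)" by (simp add: algebra_simps)
    finally have "p dvd x - q" using p nL by (simp add: prime_dvd_mult_iff)
    then have "p dvd (x - q) + (q - 1)" using q1 by (rule dvd_add)
    then show ?thesis by simp
  qed simp
  have pos': "x \<ge> 2 \<or> x = 1" if "x > 0" for x :: int using that by auto
  have "p dvd c' * d - 1"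
    using fst[OF c'd'(1)] pos'[of "c' * d"] pos c'd' cd by (intro key) auto
  moreover have "p dvd d' * c - 1"
    using fst'[OF c'd'(2)] pos'[of "d' * c"] pos c'd' cd by (intro key) auto
  \<comment> \<open>Modulo \<open>p\<close> the products \<open>c' * d\<close>,
    \<open>d' * c\<close> and \<open>q\<close> are 1, and
    \<open>(c' * d) * (d' * c) = (c' * d') * q\<close>.\<close>
  ultimately have "p dvd (c' * d - 1) * (d' * c) + (d' * c - 1)"
    by (rule dvd_add[OF dvd_mult2])
  then have "p dvd (c' * d - 1) * (d' * c) + (d' * c - 1) - c' * d' * (q - 1)"
    using q1 by (rule dvd_diff[OF _ dvd_mult])
  also have "\<dots> = c' * d' - 1" by (simp add: q algebra_simps)
  finally show ?thesis .
qed

section \<open>Transitivity\<close>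

text \<open>Take a prime dividing \<open>k\<close>. For large \<open>l\<close> all counts reach
  \<open>N\<close>, so the truncated subtractions become integer ones, and
  \<open>prime_dvd_block_exponents\<close> contradicts \<open>lattice\<close>.\<close>

lemma generic_block_size_1:
  fixes C D :: "nat set" and k N :: nat
  assumes k: "k > 0" and N: "N > 0"
    and fst: "\<And>c c' d l. c \<in> C \<Longrightarrow> c' \<in> C \<Longrightarrow> d \<in> D \<Longrightarrow> c * d \<ge> 2 \<Longrightarrow> c' * d \<ge> 2 \<Longrightarrow>
      c' * d * (c * d) ^ l - 1 \<ge> N \<Longrightarrow> k dvd c' * d * (c * d) ^ l - 1 - (N - 1)"
    and fst': "\<And>c d d' l. c \<in> C \<Longrightarrow> d \<in> D \<Longrightarrow> d' \<in> D \<Longrightarrow> c * d \<ge> 2 \<Longrightarrow> d' * c \<ge> 2 \<Longrightarrow>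
      d' * c * (d * c) ^ l - 1 \<ge> N \<Longrightarrow> k dvd d' * c * (d * c) ^ l - 1 - (N - 1)"
    and snd: "\<And>c d l. c \<in> C \<Longrightarrow> d \<in> D \<Longrightarrow> c * d \<ge> 2 \<Longrightarrow> l > 0 \<Longrightarrow>
      d * ((c * d) ^ l - 1) \<ge> N \<Longrightarrow> k dvd d * ((c * d) ^ l - 1) - (N - 1)"
    and snd': "\<And>c d l. c \<in> C \<Longrightarrow> d \<in> D \<Longrightarrow> c * d \<ge> 2 \<Longrightarrow> l > 0 \<Longrightarrow>
      c * ((d * c) ^ l - 1) \<ge> N \<Longrightarrow> k dvd c * ((d * c) ^ l - 1) - (N - 1)"
    and pos: "0 \<notin> C" "0 \<notin> D"
    and lattice: "\<And>p :: int. prime p \<Longrightarrow> \<exists>c\<in>C. \<exists>d\<in>D. \<not> p dvd int c * int d - 1"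
  shows "k = 1"
proof (rule ccontr)
  assume "k \<noteq> 1"
  then obtain p where p: "prime p" "p dvd k" using prime_factor_nat by blast
  have x0: "x > 0" if "x \<in> C \<or> x \<in> D" for x using that pos by (metis gr0I)
  \<comment> \<open>The prime 2 excludes \<open>c * d = 1\<close> and so provides a product of at
    least 2, whose powers grow.\<close>
  obtain c d where "c \<in> C" "d \<in> D" and odd: "\<not> 2 dvd int c * int d - 1"
    using lattice[of 2] by auto
  moreover have "c * d \<noteq> 1" using odd by auto
  moreover have "c * d > 0" using x0 calculation by auto
  ultimately have cd: "c \<in> C" "d \<in> D" "c * d \<ge> 2" by linarith+
  define q where "q = c * d"
  have large: "N + 1 \<le> q ^ l" if "l \<ge> N + 1" for l
  proof -
    have "N + 1 \<le> l" using that .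
    also have "l < 2 ^ l" by (rule less_exp)
    also have "2 ^ l \<le> q ^ l" using cd by (simp add: q_def power_mono)
    finally show ?thesis by simp
  qed
  obtain c' d' where c'd': "c' \<in> C" "d' \<in> D" "\<not> int p dvd int c' * int d' - 1"
    using lattice[of "int p"] p by auto
  have dvd_int: "int p dvd int M - int N" if "k dvd M - 1 - (N - 1)" "N + 1 \<le> M" for M
  proof -
    have "M - 1 - (N - 1) = M - N" using N by simp
    then have "p dvd M - N" using that p(2) by (metis dvd_trans)
    then show ?thesis using that by (metis add_leE of_nat_diff of_nat_dvd_iff)
  qed
  have dvd_int': "int p dvd int M - (int N - 1)" if "k dvd M - (N - 1)" "N \<le> M" for M
  proof -
    have "p dvd M - (N - 1)" using that p(2) by (metis dvd_trans)
    moreover have "int (M - (N - 1)) = int M - (int N - 1)" using that N by simp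
    ultimately show ?thesis by (metis of_nat_dvd_iff)
  qed
  have mult_large: "N + 1 \<le> x * q ^ l" if "x \<ge> 1" "l \<ge> N + 1" for x l
    using large[OF that(2)] that(1) by (metis le_trans mult_le_mono1 mult_1)
  have "2 \<le> int c * int d" using cd(3) by (metis of_nat_le_iff of_nat_mult of_nat_numeral)
  moreover have "int p dvd int c' * int d' - 1" if "2 \<le> int c * int d"
  proof (rule prime_dvd_block_exponents[where q = "int q" and N = "int N" and C = "int ` C"
        and D = "int ` D" and L = "N + 1" and c = "int c" and d = "int d"])
    show "int p dvd x * int d * int q ^ l - int N"
      if x: "x \<in> int ` C" "x * int d \<ge> 2" "l \<ge> N + 1" for x l
    proof -
      obtain y where y: "x = int y" "y \<in> C" using x(1) by blast
      have y2: "y * d \<ge> 2" using x(2) unfolding y by (metis of_nat_le_iff of_nat_mult of_nat_numeral)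
      have "N + 1 \<le> y * d * q ^ l" by (rule mult_large[OF _ x(3)]) (use y2 in linarith)
      then have "int p dvd int (y * d * q ^ l) - int N"
        using fst[OF cd(1) y(2) cd(2,3) y2, of l] by (intro dvd_int) (auto simp: q_def)
      then show ?thesis by (simp add: y)
    qed
    show "int p dvd x * int c * int q ^ l - int N"
      if x: "x \<in> int ` D" "x * int c \<ge> 2" "l \<ge> N + 1" for x l
    proof -
      obtain y where y: "x = int y" "y \<in> D" using x(1) by blast
      have y2: "y * c \<ge> 2" using x(2) unfolding y by (metis of_nat_le_iff of_nat_mult of_nat_numeral)
      have "N + 1 \<le> y * c * q ^ l" by (rule mult_large[OF _ x(3)]) (use y2 in linarith)
      then have "int p dvd int (y * c * q ^ l) - int N"
        using fst'[OF cd(1,2) y(2) cd(3) y2, of l] by (intro dvd_int) (auto simp: q_def mult.commute[of d])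
      then show ?thesis by (simp add: y)
    qed
    have N': "N \<le> x * (q ^ (N + 1) - 1)" if "x > 0" for x
      using large[of "N + 1"] that by (metis One_nat_def Suc_leI add_diff_cancel_right'
          diff_le_mono le_refl le_trans mult_1 mult_le_mono1)
    have int_eq: "int (x * (q ^ (N + 1) - 1)) = int x * (int q ^ (N + 1) - 1)" for x
      using large[of "N + 1"] by (simp add: of_nat_diff del: power_Suc)
    have "k dvd d * (q ^ (N + 1) - 1) - (N - 1)" "k dvd c * (q ^ (N + 1) - 1) - (N - 1)"
      using snd[OF cd, of "N + 1"] snd'[OF cd, of "N + 1"] N'[of d] N'[of c] x0 cd
      unfolding q_def mult.commute[of d c] by auto
    then show "int p dvd int d * (int q ^ (N + 1) - 1) - (int N - 1)"
      "int p dvd int c * (int q ^ (N + 1) - 1) - (int N - 1)"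
      using dvd_int'[OF _ N'] x0 cd unfolding int_eq by blast+
  qed (use that p cd(1,2) c'd' x0 in \<open>auto simp: q_def\<close>)
  ultimately show False using c'd' by blast
qed

section \<open>Zero counts on the axes\<close>

context positive_shears
begin

lemma fst_in_FF: "fst \<in> FF" and snd_in_FF: "snd \<in> FF"
  by (rule fst_in_coords snd_in_coords)+

lemma card_common_zeros_axis:
  "card (common_zeros snd E) = card {t. t \<noteq> 0 \<and> E (t, 0) = 0}"
  "card (common_zeros fst E) = card {t. t \<noteq> 0 \<and> E (0, t) = 0}"
proof -
  have "common_zeros snd E = (\<lambda>t. (t, 0)) ` {t. t \<noteq> 0 \<and> E (t, 0) = 0}"
    by (auto simp: common_zeros_def)
  then show "card (common_zeros snd E) = card {t. t \<noteq> 0 \<and> E (t, 0) = 0}"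
    by (simp add: card_image inj_on_def)
  have "common_zeros fst E = (\<lambda>t. (0, t)) ` {t. t \<noteq> 0 \<and> E (0, t) = 0}"
    by (auto simp: common_zeros_def)
  then show "card (common_zeros fst E) = card {t. t \<noteq> 0 \<and> E (0, t) = 0}"
    by (simp add: card_image inj_on_def)
qed

lemma common_zeros_card:
  assumes cd: "c \<in> C" "d \<in> D" "c * d \<ge> 2"
  shows "c' \<in> C \<Longrightarrow> c' * d \<ge> 2 \<Longrightarrow>
      \<exists>E\<in>FF. card (common_zeros snd E) = c' * d * (c * d) ^ l - 1"
    and "d' \<in> D \<Longrightarrow> d' * c \<ge> 2 \<Longrightarrow>
      \<exists>E\<in>FF. card (common_zeros fst E) = d' * c * (d * c) ^ l - 1"
    and "l > 0 \<Longrightarrow> \<exists>E\<in>FF. card (common_zeros snd E) = d * ((c * d) ^ l - 1)"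
    and "l > 0 \<Longrightarrow> \<exists>E\<in>FF. card (common_zeros fst E) = c * ((d * c) ^ l - 1)"
proof -
  \<comment> \<open>Counts on the axis \<open>x = 0\<close> come from those on \<open>y = 0\<close>
    for the exchanged exponent sets.\<close>
  have swap: "\<exists>E\<in>FF. card (common_zeros fst E) = M"
    if M: "\<exists>E \<in> coords D C. card {t :: 'a. t \<noteq> 0 \<and> E (t, 0) = 0} = M" for M
  proof -
    obtain E where E: "E \<in> coords D C" "card {t :: 'a. t \<noteq> 0 \<and> E (t, 0) = 0} = M"
      using M by blast
    show ?thesis
      by (rule bexI[OF _ coords_swap[OF E(1)]]) (simp add: card_common_zeros_axis E(2))
  qed
  have dc: "d * c \<ge> 2" using cd by (simp add: mult.commute)
  show "\<exists>E\<in>FF. card (common_zeros snd E) = c' * d * (c * d) ^ l - 1" if "c' \<in> C" "c' * d \<ge> 2"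
    unfolding card_common_zeros_axis by (rule coords_card_zeros_fst[OF pos cd that])
  show "\<exists>E\<in>FF. card (common_zeros fst E) = d' * c * (d * c) ^ l - 1" if "d' \<in> D" "d' * c \<ge> 2"
    by (rule swap[OF coords_card_zeros_fst[OF pos(2,1) cd(2,1) dc that]])
  show "\<exists>E\<in>FF. card (common_zeros snd E) = d * ((c * d) ^ l - 1)" if "l > 0"
    unfolding card_common_zeros_axis by (rule coords_card_zeros_snd[OF pos cd that])
  show "\<exists>E\<in>FF. card (common_zeros fst E) = c * ((d * c) ^ l - 1)" if "l > 0"
    by (rule swap[OF coords_card_zeros_snd[OF pos(2,1) cd(2,1) dc that]])
qed

end

text \<open>The lattice condition prime by prime: \<open>1 - c * d\<close> is the determinant of the
  vectors \<open>(-1, c)\<close> and \<open>(d, -1)\<close>, and no prime divides all of these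
  determinants.\<close>

locale generating_shears = positive_shears +
  assumes lattice: "\<And>p :: int. prime p \<Longrightarrow> \<exists>c\<in>C. \<exists>d\<in>D. \<not> p dvd int c * int d - 1"
begin

lemma exponents_ge_2:
  obtains c d where "c \<in> C" "d \<in> D" "c * d \<ge> 2"
proof -
  obtain c d where cd: "c \<in> C" "d \<in> D" "\<not> 2 dvd int c * int d - 1"
    using lattice[of 2] by auto
  have "c \<noteq> 0" "d \<noteq> 0" using cd(1,2) pos by metis+
  moreover have "c * d \<noteq> 1" using cd(3) by auto
  ultimately have "c * d \<ge> 2" by (metis One_nat_def Suc_1 Suc_leI less_one linorder_neqE_nat mult_is_0)
  then show ?thesis using that cd by blast
qed

lemma large_common_zeros:
  obtains E where "E \<in> FF" "card (common_zeros snd E) \<ge> N"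
proof -
  obtain c d where cd: "c \<in> C" "d \<in> D" "c * d \<ge> 2" by (rule exponents_ge_2)
  obtain E where E: "E \<in> FF" "card (common_zeros snd E) = c * d * (c * d) ^ N - 1"
    using common_zeros_card(1)[OF cd cd(1,3), of N] by blast
  have "N < 2 ^ N" by (rule less_exp)
  also have "2 ^ N \<le> 1 * (c * d) ^ N" using cd by (simp add: power_mono)
  also have "1 * (c * d) ^ N \<le> c * d * (c * d) ^ N" using cd(3) by (intro mult_le_mono1) linarith
  finally show ?thesis using that E by simp
qed

text \<open>The excess \<open>k\<close> of a block over \<open>N - 1\<close> divides every zero
  count minus \<open>N - 1\<close>. The counts on both axes force \<open>k = 1\<close>, so the block
  of \<open>P\<close> has no more points than \<open>P\<close>.\<close>

lemma cl_eq:
  assumes tr: "set_transitive N" and P: "(0, 0) \<notin> P" "finite P" "card P = N"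
  shows "cl P = P"
proof (cases "N = 0")
  \<comment> \<open>The block argument fixes \<open>N - 1\<close> points and needs
    \<open>N \<ge> 1\<close>. For empty \<open>P\<close>, already \<open>fst\<close> and
    \<open>snd\<close> have no common zero off the origin.\<close>
  case True
  then have "P = {}" using P by simp
  have "z \<notin> cl {}" for z
  proof
    assume "z \<in> cl {}"
    then have z: "z \<noteq> (0, 0)" "\<forall>F\<in>FF. F z = 0" by (simp_all add: cl_def)
    have "fst z = 0" "snd z = 0" using bspec[OF z(2)] fst_in_FF snd_in_FF by blast+
    then show False using z(1) by (simp add: prod_eq_iff)
  qed
  then show ?thesis using \<open>P = {}\<close> by auto
next
  case False
  then have N: "N \<ge> 1" by simp
  define k where "k = card (cl P) - (N - 1)"
  have dvd: "finite (cl P) \<and> k dvd card (common_zeros F E) - (N - 1)"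
    if "F \<in> FF" "E \<in> FF" "N \<le> card (common_zeros F E)" for F E
  proof -
    have "(0, 0) \<notin> common_zeros F E" by (simp add: common_zeros_def)
    then show ?thesis
      using card_block_dvd[OF tr N _ cl_common_zeros[OF that(1,2)] that(3) P] by (simp add: k_def)
  qed
  obtain E where "E \<in> FF" "card (common_zeros snd E) \<ge> N" by (rule large_common_zeros)
  then have fin: "finite (cl P)" using dvd[OF snd_in_FF] by blast
  have sub: "P \<subseteq> cl P" using cl_superset[OF P(1)] .
  then have "card (cl P) \<ge> N" using card_mono[OF fin sub] P by simp
  then have "k > 0" using N by (simp add: k_def)
  have "k = 1"
  proof (rule generic_block_size_1[OF \<open>k > 0\<close> _ _ _ _ _ pos lattice])
    show "N > 0" using N by simp
    show "k dvd c' * d * (c * d) ^ l - 1 - (N - 1)"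
      (is "k dvd ?M - (N - 1)")
      if h: "c \<in> C" "c' \<in> C" "d \<in> D" "c * d \<ge> 2" "c' * d \<ge> 2" "c' * d * (c * d) ^ l - 1 \<ge> N" for c c' d l
    proof -
      obtain E where "E \<in> FF" "card (common_zeros snd E) = ?M"
        using common_zeros_card(1)[OF h(1,3,4,2,5), of l] by blast
      then show ?thesis using dvd[OF snd_in_FF, of E] h(6) by simp
    qed
    show "k dvd d' * c * (d * c) ^ l - 1 - (N - 1)"
      (is "k dvd ?M - (N - 1)")
      if h: "c \<in> C" "d \<in> D" "d' \<in> D" "c * d \<ge> 2" "d' * c \<ge> 2" "d' * c * (d * c) ^ l - 1 \<ge> N" for c d d' l
    proof -
      obtain E where "E \<in> FF" "card (common_zeros fst E) = ?M"
        using common_zeros_card(2)[OF h(1,2,4,3,5), of l] by blast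
      then show ?thesis using dvd[OF fst_in_FF, of E] h(6) by simp
    qed
    show "k dvd d * ((c * d) ^ l - 1) - (N - 1)"
      (is "k dvd ?M - (N - 1)")
      if h: "c \<in> C" "d \<in> D" "c * d \<ge> 2" "l > 0" "d * ((c * d) ^ l - 1) \<ge> N" for c d l
    proof -
      obtain E where "E \<in> FF" "card (common_zeros snd E) = ?M"
        using common_zeros_card(3)[OF h(1-4)] by blast
      then show ?thesis using dvd[OF snd_in_FF, of E] h(5) by simp
    qed
    show "k dvd c * ((d * c) ^ l - 1) - (N - 1)"
      (is "k dvd ?M - (N - 1)")
      if h: "c \<in> C" "d \<in> D" "c * d \<ge> 2" "l > 0" "c * ((d * c) ^ l - 1) \<ge> N" for c d l
    proof -
      obtain E where "E \<in> FF" "card (common_zeros fst E) = ?M"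
        using common_zeros_card(4)[OF h(1-4)] by blast
      then show ?thesis using dvd[OF fst_in_FF, of E] h(5) by simp
    qed
  qed
  then have "card (cl P) = card P" using P N by (simp add: k_def)
  then show ?thesis using card_subset_eq[OF fin sub] by simp
qed

text \<open>Such a pair exists for some set of \<open>N\<close> points, taken among the zeros of a
  suitable \<open>E\<close> on the axis \<open>y = 0\<close>; set transitivity transports it to
  \<open>P\<close>.\<close>

lemma nonconst_pair:
  assumes tr: "set_transitive N" and P: "(0, 0) \<notin> P" "finite P" "card P = N"
  shows "\<exists>F\<in>FF. \<exists>E\<in>FF. (\<forall>p\<in>P. F p = 0 \<and> E p = 0) \<and> (\<exists>p q. F p = F q \<and> E p \<noteq> E q)"
proof (cases "N = 0")
  case True
  have "\<exists>p q :: 'a \<times> 'a. snd p = snd q \<and> fst p \<noteq> fst q"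
    by (intro exI[of _ "(0, 0)"] exI[of _ "(1, 0)"]) simp
  moreover have "\<forall>p\<in>P. snd p = 0 \<and> fst p = 0" using P True by simp
  ultimately show ?thesis
    by (intro bexI[OF _ snd_in_FF] bexI[OF _ fst_in_FF] conjI)
next
  case False
  obtain E where E: "E \<in> FF" "card (common_zeros snd E) \<ge> N" by (rule large_common_zeros)
  \<comment> \<open>An infinite set would have \<open>card\<close> equal to 0, which is below
    \<open>N\<close>.\<close>
  then have fin: "finite (common_zeros snd E)" using False by (metis card.infinite le_zero_eq)
  obtain Q where Q: "Q \<subseteq> common_zeros snd E" "card Q = N"
    using E(2) by (rule obtain_subset_with_card_n)
  have "finite Q" using finite_subset[OF Q(1) fin] .
  have "(0, 0) \<notin> Q" using Q(1) by (auto simp: common_zeros_def)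
  then obtain g where g: "g \<in> G" "g ` P = Q"
    using tr P Q(2) \<open>finite Q\<close> unfolding set_transitive_def by blast
  obtain g' where g': "g' \<in> G" "\<And>p. g' (g p) = p" "\<And>p. g (g' p) = p"
    using inverse_in_G[OF g(1)] by blast
  have "common_zeros snd E \<noteq> {}" using E(2) False by auto
  then obtain q where q: "q \<in> common_zeros snd E" by blast
  \<comment> \<open>Otherwise the whole punctured axis would lie in the finite set of common
    zeros.\<close>
  have "\<exists>t. E (t, 0) \<noteq> 0"
  proof (rule ccontr)
    assume "\<not> ?thesis"
    then have "(\<lambda>t. (t, 0)) ` (UNIV - {0}) \<subseteq> common_zeros snd E"
      by (auto simp: common_zeros_def)
    then have "finite ((\<lambda>t. (t, 0 :: 'a)) ` (UNIV - {0 :: 'a}))" using fin by (rule finite_subset)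
    then have "finite (UNIV - {0 :: 'a})" by (rule finite_imageD) (simp add: inj_on_def)
    then show False using infinite_UNIV_char_0[where 'a = 'a] by simp
  qed
  then obtain t where t: "E (t, 0) \<noteq> 0" by blast
  have "snd (g (g' q)) = snd (g (g' (t, 0)))" "E (g (g' q)) \<noteq> E (g (g' (t, 0)))"
    using q t by (auto simp: g' common_zeros_def)
  then have "\<exists>p q. snd (g p) = snd (g q) \<and> E (g p) \<noteq> E (g q)"
    by (intro exI[of _ "g' q"] exI[of _ "g' (t, 0)"]) simp
  moreover have "\<forall>p\<in>P. snd (g p) = 0 \<and> E (g p) = 0"
    using g(2) Q(1) unfolding common_zeros_def by blast
  ultimately show ?thesis
    by (intro bexI[OF _ FF_comp[OF snd_in_FF g(1)]] bexI[OF _ FF_comp[OF E(1) g(1)]] conjI)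
qed

section \<open>Induction on the number of points\<close>

definition tuple_transitive :: "nat \<Rightarrow> bool"
  where "tuple_transitive n \<longleftrightarrow> (\<forall>p q :: nat \<Rightarrow> 'a \<times> 'a. inj_on p {1..n} \<and> inj_on q {1..n} \<and>
    (0, 0) \<notin> p ` {1..n} \<and> (0, 0) \<notin> q ` {1..n} \<longrightarrow> (\<exists>g\<in>G. \<forall>i\<in>{1..n}. g (p i) = q i))"

lemma tuple_transitiveD:
  assumes "tuple_transitive n" "inj_on p {1..n}" "inj_on q {1..n}"
    "(0, 0) \<notin> p ` {1..n}" "(0, 0) \<notin> q ` {1..n}"
  shows "\<exists>g\<in>G. \<forall>i\<in>{1..n}. g (p i) = q i"
  using assms(1)[unfolded tuple_transitive_def, rule_format, of p q] assms(2-) by fast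

lemma set_transitive_if_tuple_transitive:
  assumes "tuple_transitive n"
  shows "set_transitive n"
  unfolding set_transitive_def
proof (intro allI impI)
  fix P Q :: "('a \<times> 'a) set"
  assume *: "finite P \<and> finite Q \<and> card P = n \<and> card Q = n \<and> (0, 0) \<notin> P \<and> (0, 0) \<notin> Q"
  obtain p where "bij_betw p {1..n} P" using ex_bij_betw_nat_finite_1[of P] * by auto
  then have p: "inj_on p {1..n}" "p ` {1..n} = P" by (simp_all only: bij_betw_def)
  obtain q where "bij_betw q {1..n} Q" using ex_bij_betw_nat_finite_1[of Q] * by auto
  then have q: "inj_on q {1..n}" "q ` {1..n} = Q" by (simp_all only: bij_betw_def)
  have "\<exists>g\<in>G. \<forall>i\<in>{1..n}. g (p i) = q i"
    by (rule tuple_transitiveD[OF assms p(1) q(1)]) (simp_all only: p q * not_False_eq_True)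
  then obtain g where g: "g \<in> G" "\<forall>i\<in>{1..n}. g (p i) = q i" by (elim bexE)
  have "g ` P = Q" unfolding p(2)[symmetric] q(2)[symmetric] image_image using g(2) by (intro image_cong) auto
  then show "\<exists>g\<in>G. g ` P = Q" using g(1) by (rule bexI)
qed

text \<open>The induction hypothesis moves the first \<open>n\<close> points into place and, through
  \<open>set_transitive\<close>, gives \<open>cl P = P\<close>. So the stabilizer of
  \<open>P\<close> can move the last point while fixing the others.\<close>

lemma tuple_transitive: "tuple_transitive n"
proof (induction n)
  case 0
  show ?case using id_in_G by (auto simp: tuple_transitive_def)
next
  case (Suc n)
  show ?case
    unfolding tuple_transitive_def
  proof (intro allI impI)
    fix p q :: "nat \<Rightarrow> 'a \<times> 'a"
    assume *: "inj_on p {1..Suc n} \<and> inj_on q {1..Suc n} \<and>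
      (0, 0) \<notin> p ` {1..Suc n} \<and> (0, 0) \<notin> q ` {1..Suc n}"
    have sub: "{1..n} \<subseteq> {1..Suc n}" by auto
    have inj: "inj_on p {1..Suc n}" "inj_on q {1..Suc n}" using * by blast+
    have zero: "(0, 0) \<notin> p ` {1..n}" "(0, 0) \<notin> q ` {1..n}"
      using * image_mono[OF sub, of p] image_mono[OF sub, of q] by (auto dest: subsetD)
    from tuple_transitiveD[OF Suc inj_on_subset[OF inj(1) sub] inj_on_subset[OF inj(2) sub] zero]
    obtain g where g: "g \<in> G" "\<forall>i\<in>{1..n}. g (p i) = q i" by (elim bexE)
    define P where "P = q ` {1..n}"
    have P: "(0, 0) \<notin> P" "finite P" "card P = n"
      using zero(2) card_image[OF inj_on_subset[OF inj(2) sub]] by (simp_all add: P_def)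
    have tr: "set_transitive n" using set_transitive_if_tuple_transitive[OF Suc] .
    have new: "r (Suc n) \<notin> r ` {1..n}" if r: "inj_on r {1..Suc n}" for r :: "nat \<Rightarrow> 'a \<times> 'a"
    proof
      assume "r (Suc n) \<in> r ` {1..n}"
      then obtain i where i: "i \<in> {1..n}" "r (Suc n) = r i" by blast
      then have "Suc n = i" using inj_onD[OF r i(2)] by simp
      then show False using i(1) by simp
    qed
    have w: "q (Suc n) \<notin> cl P"
      unfolding cl_eq[OF tr P] unfolding P_def using * new[of q] by simp
    have "p (Suc n) \<notin> p ` {1..n}" using * new[of p] by simp
    moreover have "q ` {1..n} = g ` (p ` {1..n})"
      unfolding image_image using g(2) by (intro image_cong) auto
    moreover have "inj g" using inj_G[OF g(1)] by (rule injI[OF iffD1])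
    ultimately have z: "g (p (Suc n)) \<notin> cl P"
      unfolding cl_eq[OF tr P] unfolding P_def by (simp only: inj_image_mem_iff not_False_eq_True)
    have "p (Suc n) \<in> p ` {1..Suc n}" "q (Suc n) \<in> q ` {1..Suc n}" by auto
    then have w0: "q (Suc n) \<noteq> (0, 0)" "g (p (Suc n)) \<noteq> (0, 0)"
      unfolding G_eq_0_iff[OF g(1)] using * by metis+
    have "\<exists>F\<in>FF. (\<forall>p\<in>P. F p = 0) \<and> F x \<noteq> 0" if "x \<notin> cl P" "x \<noteq> (0, 0)" for x
      using that unfolding cl_def by simp
    note separate = this
    obtain F1 where F1: "F1 \<in> FF" "\<And>p. p \<in> P \<Longrightarrow> F1 p = 0" "F1 (g (p (Suc n))) \<noteq> 0"
      using separate[OF z w0(2)] by (elim bexE conjE) simp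
    obtain F2 where F2: "F2 \<in> FF" "\<And>p. p \<in> P \<Longrightarrow> F2 p = 0" "F2 (q (Suc n)) \<noteq> 0"
      using separate[OF w w0(1)] by (elim bexE conjE) simp
    obtain F E where FE: "F \<in> FF" "E \<in> FF" and PFE: "\<forall>p\<in>P. F p = 0 \<and> E p = 0"
      and nonconst: "\<exists>a b. F a = F b \<and> E a \<noteq> E b"
      using nonconst_pair[OF tr P] by (elim bexE conjE)
    from nonconst obtain a b where ab: "F a = F b" "E a \<noteq> E b" by (elim exE conjE)
    have "\<exists>s\<in>G. s (g (p (Suc n))) = q (Suc n) \<and> (\<forall>p\<in>P. s p = p)"
      by (rule stabilizer_transitive[OF FE _ _ ab F1 F2]) (simp_all add: PFE)
    then obtain s where s: "s \<in> G" "s (g (p (Suc n))) = q (Suc n)" "\<forall>p\<in>P. s p = p"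
      by (elim bexE conjE)
    have "s (g (p i)) = q i" if "i \<in> {1..Suc n}" for i
    proof (cases "i = Suc n")
      case False
      then have "i \<in> {1..n}" using that by auto
      then show ?thesis using g(2) s(3) by (simp add: P_def)
    qed (use s in simp)
    then show "\<exists>g\<in>G. \<forall>i\<in>{1..Suc n}. g (p i) = q i"
      by (intro bexI[OF _ comp_in_G[OF s(1) g(1)]] ballI)
  qed
qed

end

section \<open>The lattice generated by the root vectors\<close>

abbreviation int_plane :: "(int \<times> int) monoid" where "int_plane \<equiv> integer_group \<times>\<times> integer_group"

lemma generate_int_plane_induct [consumes 1, case_names zero incl uminus add]:
  assumes "v \<in> generate int_plane S"
    and "P (0, 0)" "\<And>a b. (a, b) \<in> S \<Longrightarrow> P (a, b)" "\<And>a b. P (a, b) \<Longrightarrow> P (- a, - b)"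
    and "\<And>a b a' b'. P (a, b) \<Longrightarrow> P (a', b') \<Longrightarrow> P (a + a', b + b')"
  shows "P v"
  using assms(1)
proof (induction rule: generate.induct)
  case one
  then show ?case using assms(2) by simp
next
  case (incl h)
  then show ?case using assms(3) by (cases h) simp
next
  case (inv h)
  then show ?case using assms(3,4) by (cases h) (simp add: inv_DirProd)
next
  case (eng h1 h2)
  then show ?case
    using assms(5)[of "fst h1" "snd h1" "fst h2" "snd h2"] by (simp add: DirProd_def case_prod_beta)
qed

lemma generate_int_plane_closed:
  shows "(0, 0) \<in> generate int_plane S"
    and "(a, b) \<in> generate int_plane S \<Longrightarrow> (a', b') \<in> generate int_plane S \<Longrightarrow>
      (a + a', b + b') \<in> generate int_plane S"
    and "(a, b) \<in> generate int_plane S \<Longrightarrow> (n * a, n * b) \<in> generate int_plane S"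
proof -
  interpret group int_plane by (intro DirProd_group group_integer_group)
  have sub: "S \<subseteq> carrier int_plane" by simp
  show "(0, 0) \<in> generate int_plane S" using generate.one[of int_plane S] by simp
  show "(a + a', b + b') \<in> generate int_plane S"
    if "(a, b) \<in> generate int_plane S" "(a', b') \<in> generate int_plane S" for a b a' b'
    using generate.eng[OF that] by simp
  note add = this
  have neg: "(- a, - b) \<in> generate int_plane S" if "(a, b) \<in> generate int_plane S" for a b
    using generate_m_inv_closed[OF sub that] by (simp add: inv_DirProd)
  have nat: "(int k * a, int k * b) \<in> generate int_plane S" if "(a, b) \<in> generate int_plane S" for a b k
  proof (induction k)
    case 0
    then show ?case using \<open>(0, 0) \<in> generate int_plane S\<close> by simp
  next
    case (Suc k)
    then show ?case using add[OF that Suc] by (simp add: algebra_simps)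
  qed
  show "(n * a, n * b) \<in> generate int_plane S" if "(a, b) \<in> generate int_plane S"
    using nat[OF that, of "nat n"] neg[OF nat[OF that, of "nat (- n)"]] by (cases "n \<ge> 0") auto
qed

text \<open>Division with remainder by the least positive member; the zero subgroup gives
  \<open>m = 0\<close>. The generator is a \<open>nat\<close> because it will serve as an
  exponent.\<close>

lemma int_subgroup_multiples:
  fixes I :: "int set"
  assumes "0 \<in> I" "\<And>a b. a \<in> I \<Longrightarrow> b \<in> I \<Longrightarrow> a + b \<in> I" "\<And>a n. a \<in> I \<Longrightarrow> n * a \<in> I"
  obtains m :: nat where "int m \<in> I" "\<And>a. a \<in> I \<Longrightarrow> int m dvd a"
proof (cases "\<exists>k>0. int k \<in> I")
  case True
  define m where "m = (LEAST k. k > 0 \<and> int k \<in> I)"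
  have m: "m > 0" "int m \<in> I" using LeastI_ex[OF True] by (simp_all add: m_def)
  have "int m dvd a" if "a \<in> I" for a
  proof (rule ccontr)
    assume "\<not> int m dvd a"
    then have "a mod int m \<noteq> 0" by (simp add: dvd_eq_mod_eq_0)
    moreover have "a mod int m \<ge> 0" using m(1) by simp
    ultimately have r: "a mod int m > 0" by linarith
    have "a mod int m = a + (- (a div int m)) * int m" using minus_div_mult_eq_mod[of a "int m"] by simp
    then have "a mod int m \<in> I" using assms(2)[OF that assms(3)[OF m(2)]] by (simp only:)
    then have "nat (a mod int m) > 0 \<and> int (nat (a mod int m)) \<in> I" using r by simp
    then have "m \<le> nat (a mod int m)" unfolding m_def by (rule Least_le)
    moreover have "a mod int m < int m" using m(1) by simp
    ultimately show False using r by linarith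
  qed
  then show ?thesis using that m by blast
next
  case False
  have "a = 0" if "a \<in> I" for a
  proof (rule ccontr)
    assume "a \<noteq> 0"
    then have "int (nat \<bar>a\<bar>) \<in> I" using that assms(3)[OF that, of "-1"] by (cases "a > 0") auto
    then show False using False \<open>a \<noteq> 0\<close> by (metis zero_less_abs_iff zero_less_nat_eq)
  qed
  then show ?thesis using that[of 0] assms(1) by simp
qed

text \<open>For \<open>m \<ge> 2\<close> take a zero of the geometric sum with \<open>m\<close>
  terms, which is nonconstant as its values at 0 and 1 are 1 and \<open>m\<close>. For
  \<open>m = 0\<close> every power is 1 and 2 serves.\<close>

lemma nontrivial_root_of_unity:
  assumes "m \<noteq> 1"
  obtains u :: "'a::{field_char_0, alg_closed_field}" where "u \<noteq> 0" "u \<noteq> 1" "u ^ m = 1"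
proof (cases "m = 0")
  case True
  then show ?thesis using that[of 2] by simp
next
  case False
  define p :: "'a poly" where "p = (\<Sum>k<m. monom 1 k)"
  have p: "poly p x = (\<Sum>k<m. x ^ k)" for x by (simp add: p_def poly_sum poly_monom)
  have "poly p 0 = 1" using False by (simp add: p power_0_left sum.delta)
  moreover have "poly p 1 = of_nat m" by (simp add: p)
  moreover have "(of_nat m :: 'a) \<noteq> 1" using assms by (metis of_nat_1 of_nat_eq_iff)
  ultimately obtain u where u: "poly p u = 0"
    using poly_surj_if_nonconst[of p 0 1] by metis
  have "u ^ m = 1" using power_diff_1_eq[of u m] u p by simp
  moreover have "u \<noteq> 1" using u False by (auto simp: p)
  moreover have "u \<noteq> 0" using \<open>u ^ m = 1\<close> False by (auto simp: power_0_left)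
  ultimately show ?thesis using that by blast
qed

lemma power_eq_if_dvd_diff:
  fixes u :: "'a::field"
  assumes "u ^ m = 1" "int m dvd int a - int b"
  shows "u ^ a = u ^ b"
  using assms(2)
proof (induction a b rule: linorder_wlog)
  case (le a b)
  then have "int m dvd int (b - a)" by (metis dvd_minus_iff minus_diff_eq of_nat_diff)
  then obtain k where "b - a = m * k" by (auto simp only: of_nat_dvd_iff elim: dvdE)
  then have "b = a + m * k" using le by simp
  then show ?case using assms(1) by (simp add: power_add power_mult)
next
  case (sym a b)
  then show ?case by (metis dvd_minus_iff minus_diff_eq)
qed

section \<open>The criterion\<close>

locale root_subgroups =
  fixes s m :: nat and c d :: "nat \<Rightarrow> nat"
    and G :: "('k :: {field_char_0, alg_closed_field} \<times> 'k \<Rightarrow> 'k \<times> 'k) monoid"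
  assumes s: "s > 0" and m: "m > 0"
    and G: "G = subgroup_generated Aut_plane ((\<Union>i\<in>{1..s}. H (c i)) \<union> (\<Union>j\<in>{1..m}. K (d j)))"
    and c_pos: "\<And>i. i \<in> {1..s} \<Longrightarrow> c i > 0" and d_pos: "\<And>j. j \<in> {1..m} \<Longrightarrow> d j > 0"
begin

abbreviation gens where "gens \<equiv> (\<Union>i\<in>{1..s}. H (c i)) \<union> (\<Union>j\<in>{1..m}. K (d j)) :: ('k \<times> 'k \<Rightarrow> 'k \<times> 'k) set"

abbreviation vectors where
  "vectors \<equiv> (\<lambda>i. (-1, int (c i))) ` {1..s} \<union> (\<lambda>j. (int (d j), -1)) ` {1..m}"

lemma Aut_plane_simps:
  "\<one>\<^bsub>Aut_plane\<^esub> = id" "f \<otimes>\<^bsub>Aut_plane\<^esub> g = f \<circ> g"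
  by (simp_all add: Aut_plane_def)

lemma carrier_G: "carrier G = generate Aut_plane gens"
proof -
  have "gens \<subseteq> carrier Aut_plane"
    using H_subset_Aut_plane K_subset_Aut_plane by blast
  then show ?thesis by (simp add: G carrier_subgroup_generated Int_absorb1)
qed

lemma shear_group_subset: "shear_group (c ` {1..s}) (d ` {1..m}) \<subseteq> carrier G"
proof
  fix g :: "'k \<times> 'k \<Rightarrow> 'k \<times> 'k" assume "g \<in> shear_group (c ` {1..s}) (d ` {1..m})"
  then show "g \<in> carrier G"
    unfolding carrier_G
  proof (induction rule: shear_group.induct)
    case id
    then show ?case using generate.one[of Aut_plane gens] by (simp only: Aut_plane_simps)
  next
    case (H a h g)
    then have "h \<in> gens" by auto
    then show ?case
      using generate.eng[OF generate.incl H.IH] by (simp only: Aut_plane_simps)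
  next
    case (K b h g)
    then have "h \<in> gens" by auto
    then show ?case
      using generate.eng[OF generate.incl K.IH] by (simp only: Aut_plane_simps)
  qed
qed

lemma transitive_if_generates:
  assumes gen: "generate int_plane vectors = carrier int_plane"
    and acts: "group_action G punctured_plane (natural_action punctured_plane)"
  shows "infinitely_transitive G punctured_plane (natural_action punctured_plane)"
proof -
  interpret generating_shears "c ` {1..s}" "d ` {1..m}"
    "shear_group (c ` {1..s}) (d ` {1..m}) :: ('k \<times> 'k \<Rightarrow> 'k \<times> 'k) set"
  proof
    fix p :: int assume p: "prime p"
    show "\<exists>a\<in>c ` {1..s}. \<exists>b\<in>d ` {1..m}. \<not> p dvd int a * int b - 1"
    proof (rule ccontr)
      assume "\<not> ?thesis"
      then have dvd: "p dvd int (c i) * int (d j) - 1" if "i \<in> {1..s}" "j \<in> {1..m}" for i j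
        using that by blast
      have 1: "1 \<in> {1..s}" "1 \<in> {1..m}" using s m by auto
      \<comment> \<open>This linear form vanishes modulo \<open>p\<close> on all root vectors, hence
        on the lattice they generate, but it equals 1 at \<open>(0, 1)\<close>.\<close>
      have "p dvd fst v * int (c 1) + snd v" if "v \<in> generate int_plane vectors" for v
        using that
      proof (induction rule: generate_int_plane_induct)
        case (incl a b)
        \<comment> \<open>Modulo \<open>p\<close> both numbers are inverse to
          \<open>d 1\<close>.\<close>
        have "p dvd int (c i) - int (c 1)" if i: "i \<in> {1..s}" for i
        proof -
          have "p dvd int (c 1) * (int (c i) * int (d 1) - 1) - int (c i) * (int (c 1) * int (d 1) - 1)"
            using dvd[OF i 1(2)] dvd[OF 1] by (rule dvd_diff[OF dvd_mult dvd_mult])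
          then show ?thesis by (simp add: algebra_simps)
        qed
        moreover have "p dvd int (d j) * int (c 1) - 1" if "j \<in> {1..m}" for j
          using dvd[OF 1(1) that] by (simp add: mult.commute)
        ultimately show ?case using incl by auto
      next
        case (uminus a b)
        then have "p dvd - (a * int (c 1) + b)" by (simp only: fst_conv snd_conv dvd_minus_iff)
        then show ?case by (simp only: fst_conv snd_conv minus_add_distrib mult_minus_left)
      next
        case (add a b a' b')
        then have "p dvd (a * int (c 1) + b) + (a' * int (c 1) + b')"
          by (simp only: fst_conv snd_conv dvd_add)
        then show ?case by (simp add: algebra_simps)
      qed simp
      moreover have "(0, 1) \<in> generate int_plane vectors" using gen by simp
      ultimately have "p dvd 1" by fastforce
      then show False using p not_prime_unit by blast
    qed
  qed (use s m c_pos d_pos in force)+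
  show ?thesis
    unfolding infinitely_transitive_def
  proof (intro conjI acts allI impI)
    fix n :: nat and p q :: "nat \<Rightarrow> 'k \<times> 'k"
    assume "n > 0" and pq: "p \<in> {1..n} \<rightarrow> punctured_plane \<and> inj_on p {1..n} \<and>
      q \<in> {1..n} \<rightarrow> punctured_plane \<and> inj_on q {1..n}"
    have "(0, 0) \<notin> p ` {1..n}" "(0, 0) \<notin> q ` {1..n}"
      using pq by (auto simp: punctured_plane_def Pi_iff)
    then obtain g where g: "g \<in> shear_group (c ` {1..s}) (d ` {1..m})" "\<forall>i\<in>{1..n}. g (p i) = q i"
      using tuple_transitiveD[OF tuple_transitive, of p n q] pq by blast
    have "\<forall>i\<in>{1..n}. natural_action punctured_plane g (p i) = q i"
      using g(2) pq by (auto simp: natural_action_def Pi_iff)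
    then show "\<exists>g\<in>carrier G. \<forall>i\<in>{1..n}. natural_action punctured_plane g (p i) = q i"
      using g(1) shear_group_subset by blast
  qed
qed

lemma generates_if_transitive:
  assumes trans: "infinitely_transitive G punctured_plane (natural_action punctured_plane)"
  shows "generate int_plane vectors = carrier int_plane"
proof (rule ccontr)
  assume not_gen: "generate int_plane vectors \<noteq> carrier int_plane"
  define L where "L = generate int_plane vectors"
  note closed = generate_int_plane_closed[where S = vectors, folded L_def]
  have 1: "1 \<in> {1..s}" "1 \<in> {1..m}" using s m by auto
  have vec: "(-1, int (c i)) \<in> L" if "i \<in> {1..s}" for i
    using that unfolding L_def by (intro generate.incl) auto
  have vec': "(int (d j), -1) \<in> L" if "j \<in> {1..m}" for j
    using that unfolding L_def by (intro generate.incl) auto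
  \<comment> \<open>\<open>n\<close> generates the vertical part of \<open>L\<close>. As
    \<open>L\<close> contains a vector with first entry -1, it would be everything if
    \<open>n\<close> were 1.\<close>
  obtain n :: nat where n: "(0, int n) \<in> L" and n_dvd: "\<And>b. (0, b) \<in> L \<Longrightarrow> int n dvd b"
  proof (rule int_subgroup_multiples[of "{b. (0, b) \<in> L}"])
    show "a + b \<in> {b. (0, b) \<in> L}" if "a \<in> {b. (0, b) \<in> L}" "b \<in> {b. (0, b) \<in> L}" for a b
      using closed(2)[of 0 a 0 b] that by simp
    show "k * a \<in> {b. (0, b) \<in> L}" if "a \<in> {b. (0, b) \<in> L}" for a k
      using closed(3)[of 0 a k] that by simp
  qed (use closed(1) in auto)
  have "n \<noteq> 1"
  proof
    assume "n = 1"
    have "(a, b) \<in> L" for a b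
    proof -
      have "(- a * - 1 + 0, - a * int (c 1) + (b + a * int (c 1)) * 1) \<in> L"
        using closed(2)[OF closed(3)[OF vec[OF 1(1)], of "- a"] closed(3)[OF n, of "b + a * int (c 1)"]]
        unfolding \<open>n = 1\<close> by simp
      then show ?thesis by (simp add: algebra_simps)
    qed
    then have "L = UNIV" by auto
    then show False using not_gen by (simp add: L_def)
  qed
  then obtain u :: 'k where u: "u \<noteq> 0" "u \<noteq> 1" "u ^ n = 1" by (rule nontrivial_root_of_unity)
  have u_c: "u ^ c i = u ^ c 1" if i: "i \<in> {1..s}" for i
  proof (rule power_eq_if_dvd_diff[OF u(3)], rule n_dvd)
    show "(0, int (c i) - int (c 1)) \<in> L"
      using closed(2)[OF vec[OF i] closed(3)[OF vec[OF 1(1)], of "- 1"]] by simp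
  qed
  have u_cd: "(u ^ c 1) ^ d j = u" if j: "j \<in> {1..m}" for j
  proof -
    have "u ^ (c 1 * d j) = u ^ 1"
    proof (rule power_eq_if_dvd_diff[OF u(3)], rule n_dvd)
      show "(0, int (c 1 * d j) - int 1) \<in> L"
        using closed(2)[OF vec'[OF j] closed(3)[OF vec[OF 1(1)], of "int (d j)"]]
        by (simp add: mult.commute)
    qed
    then show ?thesis by (simp add: power_mult)
  qed
  \<comment> \<open>The torus element of a character of the integer plane that is trivial on the
    root vectors, as \<open>u_c\<close> and \<open>u_cd\<close> express; hence it commutes with
    every generator.\<close>
  define \<tau> where "\<tau> = (\<lambda>(x, y). (u ^ c 1 * x, u * y))"
  have gens: "h (\<tau> p) = \<tau> (h p)" if "h \<in> gens" for h p
    using that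
  proof (elim UnE UN_E)
    fix i assume i: "i \<in> {1..s}" "h \<in> H (c i)"
    then show ?thesis
      by (cases p) (auto simp: H_def \<tau>_def power_mult_distrib u_c[OF i(1)] algebra_simps simp del: One_nat_def)
  next
    fix j assume j: "j \<in> {1..m}" "h \<in> K (d j)"
    then show ?thesis
      by (cases p) (auto simp: K_def \<tau>_def power_mult_distrib u_cd[OF j(1)] algebra_simps simp del: One_nat_def)
  qed
  have comm: "g (\<tau> p) = \<tau> (g p)" if "g \<in> carrier G" for g p
    using that unfolding carrier_G
  proof (induction arbitrary: p rule: generate.induct)
    case one
    then show ?case by (simp add: Aut_plane_simps)
  next
    case (incl h)
    then show ?case by (rule gens)
  next
    case (inv h)
    have hA: "h \<in> carrier Aut_plane"
      using inv H_subset_Aut_plane K_subset_Aut_plane by blast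
    have "h \<circ> inv\<^bsub>Aut_plane\<^esub> h = id" "inv\<^bsub>Aut_plane\<^esub> h \<circ> h = id"
      using group.r_inv[OF group_Aut_plane hA] group.l_inv[OF group_Aut_plane hA]
      by (simp_all add: Aut_plane_simps)
    then show ?case using gens[OF inv] by (metis comp_apply id_apply)
  next
    case (eng h1 h2)
    then show ?case by (simp add: Aut_plane_simps)
  qed
  \<comment> \<open>An element commuting with \<open>\<tau>\<close> and fixing \<open>(1, 1)\<close>
    also fixes \<open>\<tau> (1, 1)\<close>. The second coordinate of that point is
    \<open>u \<noteq> 0\<close>, so it cannot go to \<open>(1, 0)\<close>.\<close>
  define p q where "p = (\<lambda>i::nat. if i = 1 then (1, 1) else \<tau> (1, 1))"
    and "q = (\<lambda>i::nat. if i = 1 then (1 :: 'k, 1 :: 'k) else (1, 0))"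
  have "p \<in> {1..2} \<rightarrow> punctured_plane \<and> inj_on p {1..2} \<and> q \<in> {1..2} \<rightarrow> punctured_plane \<and> inj_on q {1..2}"
    using u by (auto simp: p_def q_def \<tau>_def punctured_plane_def inj_on_def)
  then obtain g where g: "g \<in> carrier G" "\<forall>i\<in>{1..2}. natural_action punctured_plane g (p i) = q i"
    using trans unfolding infinitely_transitive_def by (metis zero_less_numeral)
  have "g (1, 1) = (1, 1)" "g (\<tau> (1, 1)) = (1, 0)"
    using g(2)[rule_format, of 1] g(2)[rule_format, of 2] u
    by (simp_all add: natural_action_def p_def q_def \<tau>_def punctured_plane_def)
  then show False using comm[OF g(1), of "(1, 1)"] u by (simp add: \<tau>_def)
qed

end

theorem theorem2:
  fixes s m :: nat and c d :: "nat \<Rightarrow> nat"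
    and G :: "('k :: {field_char_0, alg_closed_field} \<times> 'k \<Rightarrow> 'k \<times> 'k) monoid"
  assumes "s > 0" and "m > 0"
  defines "G \<equiv> subgroup_generated Aut_plane ((\<Union>i\<in>{1..s}. H (c i)) \<union> (\<Union>j\<in>{1..m}. K (d j)))"
  assumes acts: "group_action G punctured_plane (natural_action punctured_plane)"
  shows "infinitely_transitive G punctured_plane (natural_action punctured_plane) \<longleftrightarrow>
    generate (integer_group \<times>\<times> integer_group)
      ((\<lambda>i. (-1, int (c i))) ` {1..s} \<union> (\<lambda>j. (int (d j), -1)) ` {1..m}) =
    carrier (integer_group \<times>\<times> integer_group)"
proof -
  \<comment> \<open>To act on the punctured plane, all generators must fix the origin, which makes
    every exponent positive.\<close>
  have "(\<forall>i\<in>{1..s}. c i > 0) \<and> (\<forall>j\<in>{1..m}. d j > 0)"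
    using acts unfolding G_def natural_action_H_K_iff .
  then interpret root_subgroups s m c d G
    using assms(1,2) by unfold_locales (auto simp: G_def)
  show ?thesis using generates_if_transitive transitive_if_generates[OF _ acts] by blast
qed

end
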